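(* Let $\alpha,\beta>-1$, let $g\in H(\mathbb{D})$, and let $0<p,q<\infty$. Then $S_g:D_\alpha^p\to D_\beta^q$ is order bounded if and only if $$\int_{\mathbb{D}}\frac{|g(z)|^q}{(1-|z|^2)^{q(\alpha+2)/p}}\,dA_\beta(z)<\infty.$$
   Context: $\mathbb{D}$ is the open unit disk in $\mathbb{C}$, $H(\mathbb{D})$ is the space of analytic functions on $\mathbb{D}$, $dA(z)=\frac1\pi\,dx\,dy$ is normalized area measure, and $dA_\beta(z)=(1-|z|^2)^\beta\,dA(z)$. For $0<p<\infty$ and $\alpha>-1$, the weighted Dirichlet space $D_\alpha^p$ is the set of $f\in H(\mathbb{D})$ with $\|f\|_{D_\alpha^p}=\left(|f(0)|^p+\int_{\mathbb{D}}|f'(z)|^p(1-|z|^2)^\alpha\,dA(z)\right)^{1/p}<\infty$. For $g\in H(\mathbb{D})$, the operator $S_g$ is $(S_gf)(z)=\int_0^z f'(\omega)g(\omega)\,d\omega$, $f\in H(\mathbb{D})$. An operator $T:D_\alpha^p\to D_\beta^q$ is called order bounded if there exists a nonnegative function $h\in L^q(A_\beta)$ such that for every $f\in D_\alpha^p$ with $\|f\|_{D_\alpha^p}\le1$ one has $|(Tf)'(z)|\le h(z)$ for $A_\beta$-almost every $z\in\mathbb{D}$. *)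

theory Defs
  imports "HOL-Complex_Analysis.Complex_Analysis"
begin

definition disk_measure :: "real \<Rightarrow> complex measure" where
  "disk_measure \<beta> =
     density (restrict_space lborel (ball 0 1)) (\<lambda>z. ennreal ((1 - (norm z)\<^sup>2) powr \<beta> / pi))"

(* Functions on the disk are represented by total functions on the complex plane;
   their values outside the unit disk are irrelevant throughout. *)
definition dirichlet_space :: "real \<Rightarrow> real \<Rightarrow> (complex \<Rightarrow> complex) set" where
  "dirichlet_space p \<alpha> =
     {f. f holomorphic_on ball 0 1 \<and>
         (\<integral>\<^sup>+ z. ennreal (norm (deriv f z) powr p) \<partial>disk_measure \<alpha>) < \<infinity>}"

(* Only meaningful for members of the space: elsewhere the Bochner integral is 0 by convention. *)
definition dirichlet_norm :: "real \<Rightarrow> real \<Rightarrow> (complex \<Rightarrow> complex) \<Rightarrow> real" where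
  "dirichlet_norm p \<alpha> f =
     (norm (f 0) powr p + (\<integral>z. norm (deriv f z) powr p \<partial>disk_measure \<alpha>)) powr (1 / p)"

definition S_op :: "(complex \<Rightarrow> complex) \<Rightarrow> (complex \<Rightarrow> complex) \<Rightarrow> complex \<Rightarrow> complex" where
  "S_op g f z = contour_integral (linepath 0 z) (\<lambda>w. deriv f w * g w)"

definition Lq_fun :: "real \<Rightarrow> 'a measure \<Rightarrow> ('a \<Rightarrow> real) \<Rightarrow> bool" where
  "Lq_fun q M h \<longleftrightarrow>
     h \<in> borel_measurable M \<and> (\<integral>\<^sup>+ x. ennreal (\<bar>h x\<bar> powr q) \<partial>M) < \<infinity>"

(* The first conjunct says that T really is a map from the one space into the other. *)
definition order_bounded ::
  "real \<Rightarrow> real \<Rightarrow> real \<Rightarrow> real \<Rightarrow> ((complex \<Rightarrow> complex) \<Rightarrow> complex \<Rightarrow> complex) \<Rightarrow> bool" where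
  "order_bounded p \<alpha> q \<beta> T \<longleftrightarrow>
     (\<forall>f\<in>dirichlet_space p \<alpha>. T f \<in> dirichlet_space q \<beta>) \<and>
     (\<exists>h. (\<forall>z\<in>ball 0 1. 0 \<le> h z) \<and> Lq_fun q (disk_measure \<beta>) h \<and>
          (\<forall>f\<in>dirichlet_space p \<alpha>. dirichlet_norm p \<alpha> f \<le> 1 \<longrightarrow>
             (AE z in disk_measure \<beta>. norm (deriv (T f) z) \<le> h z)))"

end

(* The derivative of S_g f is f' g, so an order bound for S_g is |g(z)| times the supremum of |f'(z)|
   over the unit ball of the Dirichlet space. This supremum is comparable to
   (1 - |z|^2)^(-(alpha + 2)/p): the upper bound is an area sub-mean-value inequality for |f'|^p on
   a disc of radius (1 - |z|)/2, and the lower bound comes from powers of derivatives of disk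
   automorphisms. *)
theory Submission
  imports Defs
begin

unbundle no fps_syntax

section \<open>Holomorphic substitution\<close>

text \<open>The exponent \<open>\<alpha> + 2\<close> is a scaling count: on a disc of radius
  comparable to \<open>1 - |z|\<close> the weight has the size of
  \<open>(1 - |z|^2) powr \<alpha>\<close> throughout, and the area of the disc supplies the
  remaining 2. Two obstacles shape the proof. The exponent \<open>p\<close> may lie below 1, where
  convexity no longer leads from a mean value inequality for \<open>|F|\<close> to one for
  \<open>|F| powr p\<close>. And an order bound dominates each single function only off a null set
  that depends on the function, so a supremum over uncountably many test functions cannot be read
  off pointwise. One change of variables for injective holomorphic maps serves both directions: with
  rotations it produces the area mean value inequality, with disk automorphisms it controls the
  norms of the extremal functions.\<close>

lemma distr_lborel_Complex:
  "distr lborel borel (\<lambda>v::real^2. Complex (v $ 1) (v $ 2)) = lborel"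
proof (rule lborel_eqI[symmetric])
  fix l u :: complex
  assume le: "\<And>b. b \<in> Basis \<Longrightarrow> l \<bullet> b \<le> u \<bullet> b"
  define cv where "cv z = (vector [Re z, Im z] :: real^2)" for z
  have Ba: "(Basis :: (real^2) set) = {axis 1 1, axis 2 1}"
    by (auto simp: Basis_vec_def UNIV_2)
  have ne: "(axis 1 1 :: real^2) \<noteq> axis 2 1"
    by (simp add: axis_eq_axis)
  have [measurable]: "(\<lambda>v::real^2. Complex (v $ 1) (v $ 2)) \<in> borel_measurable borel"
    by (intro borel_measurable_continuous_onI) (auto simp: Complex_eq intro!: continuous_intros)
  have pre: "(\<lambda>v::real^2. Complex (v $ 1) (v $ 2)) -` box l u = box (cv l) (cv u)"
    by (auto simp: mem_box Basis_complex_def Ba inner_axis cv_def vector_2 inner_complex_def)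
  have le': "cv l \<bullet> b \<le> cv u \<bullet> b" if "b \<in> Basis" for b
    using that le[of 1] le[of \<i>]
    by (auto simp: Ba inner_axis cv_def vector_2 inner_complex_def Basis_complex_def)
  have "emeasure (distr lborel borel (\<lambda>v::real^2. Complex (v $ 1) (v $ 2))) (box l u)
      = emeasure lborel (box (cv l) (cv u))"
    by (subst emeasure_distr) (auto simp: pre)
  also have "\<dots> = (\<Prod>b\<in>Basis. (u - l) \<bullet> b)"
    using le' ne by (subst emeasure_lborel_box)
      (auto simp: Ba inner_axis cv_def vector_2 inner_complex_def Basis_complex_def)
  finally show "emeasure (distr lborel borel (\<lambda>v::real^2. Complex (v $ 1) (v $ 2))) (box l u)
      = (\<Prod>b\<in>Basis. (u - l) \<bullet> b)" .
qed auto

text \<open>The Jacobian formula \<open>has_measure_differentiable_image\<close> concerns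
  \<open>real^'n\<close>, so everything is carried to \<open>real^2\<close> along \<open>vc\<close>
  and \<open>cv\<close>. There the derivative is multiplication by a complex number
  \<open>c\<close>, whose real determinant is \<open>|c|^2\<close>.\<close>

lemma emeasure_holomorphic_image:
  assumes "open S" and holo: "\<phi> holomorphic_on S" and inj: "inj_on \<phi> S"
    and A: "A \<in> sets borel" "A \<subseteq> S" and B: "\<phi> ` A \<in> sets borel"
  shows "emeasure lborel (\<phi> ` A) = (\<integral>\<^sup>+z\<in>A. ennreal ((norm (deriv \<phi> z))\<^sup>2) \<partial>lborel)"
proof -
  define vc where "vc = (\<lambda>v::real^2. Complex (v $ 1) (v $ 2))"
  define cv where "cv z = (vector [Re z, Im z] :: real^2)" for z
  have vc_cv [simp]: "vc (cv z) = z" for z by (simp add: vc_def cv_def)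
  have cv_vc [simp]: "cv (vc v) = v" for v by (simp add: vc_def cv_def vec_eq_iff forall_2)
  have bl_cv: "bounded_linear cv"
    unfolding linear_conv_bounded_linear[symmetric]
    by (rule linearI) (auto simp: cv_def vec_eq_iff forall_2)
  have bl_vc: "bounded_linear vc"
    unfolding linear_conv_bounded_linear[symmetric]
    by (rule linearI) (auto simp: vc_def complex_eq_iff)
  have m [measurable]: "vc \<in> borel_measurable borel"
    by (intro borel_measurable_continuous_onI linear_continuous_on bl_vc)
  have lb: "(lborel :: complex measure) = distr lborel borel vc"
    unfolding vc_def distr_lborel_Complex ..
  define D where "D z = indicator A z * (norm (deriv \<phi> z))\<^sup>2" for z
  have D_meas [measurable]: "D \<in> borel_measurable borel"
  proof -
    have "continuous_on S (deriv \<phi>)"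
      using \<open>open S\<close> holo by (intro holomorphic_on_imp_continuous_on holomorphic_deriv)
    then have "continuous_on A (\<lambda>z. (norm (deriv \<phi> z))\<^sup>2)"
      using A by (intro continuous_intros) (auto intro: continuous_on_subset)
    then show ?thesis
      unfolding D_def using A(1) borel_measurable_continuous_on_indicator[of A "\<lambda>z. (norm (deriv \<phi> z))\<^sup>2"]
      by simp
  qed
  have Dvc [measurable]: "(\<lambda>v. D (vc v)) \<in> borel_measurable borel"
    by measurable
  have Dvc0: "0 \<le> D (vc v)" for v
    by (simp add: D_def)
  have AS: "vc -` A \<in> sets borel"
    using measurable_sets[OF m A(1)] by simp
  have BS: "vc -` (\<phi> ` A) \<in> sets borel"
    using measurable_sets[OF m B] by simp
  have im: "(\<lambda>v. cv (\<phi> (vc v))) ` (vc -` A) = vc -` (\<phi> ` A)"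
  proof (intro equalityI subsetI)
    fix v assume "v \<in> vc -` (\<phi> ` A)"
    then obtain z where z: "z \<in> A" "vc v = \<phi> z" by auto
    then have "v = cv (\<phi> (vc (cv z)))" by (metis cv_vc vc_cv)
    then show "v \<in> (\<lambda>v. cv (\<phi> (vc v))) ` (vc -` A)"
      using z(1) by (intro image_eqI[of _ _ "cv z"]) auto
  qed auto
  have eA: "emeasure lborel (\<phi> ` A) = emeasure lborel (vc -` (\<phi> ` A))"
    by (subst lb) (subst emeasure_distr, use B in auto)
  have eI: "(\<integral>\<^sup>+z\<in>A. ennreal ((norm (deriv \<phi> z))\<^sup>2) \<partial>lborel) = (\<integral>\<^sup>+v. ennreal (D (vc v)) \<partial>lborel)"
  proof -
    have "(\<integral>\<^sup>+z\<in>A. ennreal ((norm (deriv \<phi> z))\<^sup>2) \<partial>lborel) = (\<integral>\<^sup>+z. ennreal (D z) \<partial>lborel)"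
      by (intro nn_integral_cong) (auto simp: D_def indicator_def)
    also have "\<dots> = (\<integral>\<^sup>+v. ennreal (D (vc v)) \<partial>lborel)"
      by (subst lb) (subst nn_integral_distr, auto)
    finally show ?thesis .
  qed
  have det: "\<bar>det (matrix (\<lambda>h. cv (c * vc h)))\<bar> = (norm c)\<^sup>2" for c
  proof -
    have "det (matrix (\<lambda>h. cv (c * vc h))) = (norm c)\<^sup>2"
      unfolding cmod_power2
      by (simp add: det_2 matrix_def cv_def vc_def axis_def power2_eq_square)
    then show ?thesis by simp
  qed
  have der: "((\<lambda>v. cv (\<phi> (vc v))) has_derivative (\<lambda>h. cv (deriv \<phi> (vc v) * vc h))) (at v within vc -` A)"
    if "v \<in> vc -` A" for v
  proof -
    have "(\<phi> has_field_derivative deriv \<phi> (vc v)) (at (vc v))"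
      using that A holo \<open>open S\<close> by (intro holomorphic_derivI[of _ S]) auto
    then have "(\<phi> has_derivative (*) (deriv \<phi> (vc v))) (at (vc v))"
      by (simp add: has_field_derivative_def)
    then have "((\<lambda>v. \<phi> (vc v)) has_derivative (\<lambda>h. deriv \<phi> (vc v) * vc h)) (at v within vc -` A)"
      using has_derivative_compose[OF bounded_linear_imp_has_derivative[OF bl_vc]] by blast
    then show ?thesis
      by (rule bounded_linear.has_derivative[OF bl_cv])
  qed
  have inj': "inj_on (\<lambda>v. cv (\<phi> (vc v))) (vc -` A)"
  proof (rule inj_onI)
    fix x y assume "x \<in> vc -` A" "y \<in> vc -` A" "cv (\<phi> (vc x)) = cv (\<phi> (vc y))"
    then have "vc x = vc y"
      using inj A by (metis inj_onD subsetD vc_cv vimageE)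
    then show "x = y" by (metis cv_vc)
  qed
  \<comment> \<open>An equivalence for every \<open>m\<close>: the area is finite exactly when the
    integral exists. Read forwards it gives equality for finite area; read backwards it shows that
    infinite area forces an infinite integral.\<close>
  have key: "vc -` (\<phi> ` A) \<in> lmeasurable \<and> measure lebesgue (vc -` (\<phi> ` A)) = m
      \<longleftrightarrow> ((\<lambda>v. (norm (deriv \<phi> (vc v)))\<^sup>2) has_integral m) (vc -` A)" for m
    using has_measure_differentiable_image[OF _ der inj', of m] AS
    unfolding im det by auto
  have D_ind: "D (vc v) = (if v \<in> vc -` A then (norm (deriv \<phi> (vc v)))\<^sup>2 else 0)" for v
    by (auto simp: D_def)
  have key2: "((\<lambda>v. (norm (deriv \<phi> (vc v)))\<^sup>2) has_integral m) (vc -` A)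
      \<longleftrightarrow> ((\<lambda>v. D (vc v)) has_integral m) UNIV" for m
    unfolding D_ind by (rule has_integral_restrict_UNIV[symmetric])
  show ?thesis
  proof (cases "emeasure lborel (vc -` (\<phi> ` A)) < \<infinity>")
    case True
    then have lm: "vc -` (\<phi> ` A) \<in> lmeasurable"
      using BS by (auto simp: fmeasurable_def)
    then have "((\<lambda>v. D (vc v)) has_integral measure lebesgue (vc -` (\<phi> ` A))) UNIV"
      using key key2 by blast
    then have "(\<integral>\<^sup>+v. ennreal (D (vc v)) \<partial>lborel) = measure lebesgue (vc -` (\<phi> ` A))"
      by (rule nn_integral_has_integral_lborel[OF Dvc Dvc0])
    also have "\<dots> = emeasure lebesgue (vc -` (\<phi> ` A))"
      using lm by (simp add: emeasure_eq_measure2)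
    also have "\<dots> = emeasure lborel (vc -` (\<phi> ` A))"
      using BS by simp
    finally show ?thesis using eA eI by simp
  next
    case False
    have "\<not> (\<integral>\<^sup>+v. ennreal (D (vc v)) \<partial>lborel) < \<infinity>"
    proof
      assume "(\<integral>\<^sup>+v. ennreal (D (vc v)) \<partial>lborel) < \<infinity>"
      then have "(\<lambda>v. D (vc v)) integrable_on UNIV"
        by (rule nn_integral_integrable_on[OF Dvc Dvc0])
      then have "vc -` (\<phi> ` A) \<in> lmeasurable"
        using key key2 unfolding integrable_on_def by blast
      then show False using False BS by (auto simp: fmeasurable_def)
    qed
    then show ?thesis using False eA eI by (simp add: less_top[symmetric])
  qed
qed

text \<open>The formula for sets says that two measures coincide: the image under
  \<open>\<phi>\<close> of area weighted by \<open>|\<phi>'|^2\<close>, and area restricted to the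
  image of \<open>S\<close>. Integrating \<open>f\<close> against both gives the formula for
  functions.\<close>

lemma nn_integral_holomorphic_substitution:
  assumes S: "open S" and holo: "\<phi> holomorphic_on S" and inj: "inj_on \<phi> S"
    and f [measurable]: "f \<in> borel_measurable borel"
  shows "(\<integral>\<^sup>+w\<in>\<phi> ` S. f w \<partial>lborel)
       = (\<integral>\<^sup>+z\<in>S. f (\<phi> z) * ennreal ((norm (deriv \<phi> z))\<^sup>2) \<partial>lborel)"
proof -
  have oS: "open (\<phi> ` S)"
    using open_mapping_thm3[OF holo S inj] .
  have cont: "continuous_on S \<phi>"
    using holo by (rule holomorphic_on_imp_continuous_on)
  have Sb [measurable]: "S \<in> sets borel" using S by simp
  have Sb' [measurable]: "\<phi> ` S \<in> sets borel" using oS by simp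
  have contd: "continuous_on S (deriv \<phi>)"
    using S holo by (intro holomorphic_on_imp_continuous_on holomorphic_deriv)
  define D where "D z = ennreal (indicator S z * (norm (deriv \<phi> z))\<^sup>2)" for z
  \<comment> \<open>Setting the map to 0 off \<open>S\<close> makes it Borel on the whole plane; the
    density \<open>D\<close> vanishes there, so these values carry no mass.\<close>
  define \<psi> where "\<psi> z = indicator S z *\<^sub>R \<phi> z" for z
  have \<psi>_meas [measurable]: "\<psi> \<in> borel_measurable borel"
    unfolding \<psi>_def using Sb cont by (rule borel_measurable_continuous_on_indicator)
  have D_meas [measurable]: "D \<in> borel_measurable borel"
  proof -
    have "continuous_on S (\<lambda>z. (norm (deriv \<phi> z))\<^sup>2)"
      using contd by (intro continuous_intros)
    then show ?thesis
      unfolding D_def using Sb borel_measurable_continuous_on_indicator[of S "\<lambda>z. (norm (deriv \<phi> z))\<^sup>2"]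
      by simp
  qed
  have eq: "distr (density lborel D) borel \<psi> = density lborel (indicator (\<phi> ` S))"
  proof (rule measure_eqI)
    fix B assume "B \<in> sets (distr (density lborel D) borel \<psi>)"
    then have B [measurable]: "B \<in> sets borel" by simp
    \<comment> \<open>The image of this preimage is the trace of \<open>B\<close> on the open image
      of \<open>S\<close>, hence Borel, as the formula for sets requires.\<close>
    define A where "A = S \<inter> \<psi> -` B"
    have A: "A \<in> sets borel" "A \<subseteq> S"
      unfolding A_def using measurable_sets[OF \<psi>_meas B] by auto
    have im: "\<phi> ` A = \<phi> ` S \<inter> B"
      by (auto simp: A_def \<psi>_def)
    have "emeasure (distr (density lborel D) borel \<psi>) B = (\<integral>\<^sup>+z\<in>(\<psi> -` B). D z \<partial>lborel)"
      using measurable_sets[OF \<psi>_meas B] by (simp add: emeasure_distr emeasure_density)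
    also have "\<dots> = (\<integral>\<^sup>+z\<in>A. ennreal ((norm (deriv \<phi> z))\<^sup>2) \<partial>lborel)"
      by (intro nn_integral_cong) (auto simp: A_def D_def indicator_def)
    also have "\<dots> = emeasure lborel (\<phi> ` S \<inter> B)"
      using emeasure_holomorphic_image[OF S holo inj A] im by simp
    also have "\<dots> = emeasure (density lborel (indicator (\<phi> ` S))) B"
      by (simp add: emeasure_density indicator_inter_arith[symmetric])
    finally show "emeasure (distr (density lborel D) borel \<psi>) B
        = emeasure (density lborel (indicator (\<phi> ` S))) B" .
  qed simp
  have "(\<integral>\<^sup>+w\<in>\<phi> ` S. f w \<partial>lborel) = (\<integral>\<^sup>+w. f w \<partial>density lborel (indicator (\<phi> ` S)))"
    by (subst nn_integral_density) (auto simp: mult.commute)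
  also have "\<dots> = (\<integral>\<^sup>+z. D z * f (\<psi> z) \<partial>lborel)"
    by (subst eq[symmetric]) (simp add: nn_integral_distr nn_integral_density)
  also have "\<dots> = (\<integral>\<^sup>+z\<in>S. f (\<phi> z) * ennreal ((norm (deriv \<phi> z))\<^sup>2) \<partial>lborel)"
    by (intro nn_integral_cong) (auto simp: D_def \<psi>_def indicator_def mult_ac)
  finally show ?thesis .
qed

section \<open>Area sub-mean-value inequalities\<close>

text \<open>Cauchy's formula at the centre, after rescaling the circle through \<open>w + u\<close>
  to the unit circle. The circle is indexed by a complex \<open>u\<close> rather than by its radius,
  so that integrating over \<open>u\<close> in a disc later yields an area integral.\<close>

lemma norm_le_circle_mean:
  assumes holo: "F holomorphic_on ball w s" and u: "norm u < s"
  shows "ennreal (norm (F w))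
    \<le> (\<integral>\<^sup>+x\<in>{0..1}. ennreal (norm (F (w + u * exp (of_real (2 * pi * x) * \<i>)))) \<partial>lborel)"
proof -
  define G where "G \<zeta> = F (w + u * \<zeta>)" for \<zeta>
  define e where "e x = exp (of_real (2 * pi * x) * \<i>)" for x
  have e1: "norm (e x) = 1" for x by (simp add: e_def)
  have "(F \<circ> (\<lambda>\<zeta>. w + u * \<zeta>)) holomorphic_on cball 0 1"
  proof (rule holomorphic_on_compose_gen[OF _ holo])
    have "norm (u * \<zeta>) < s" if "norm \<zeta> \<le> 1" for \<zeta>
      using that u by (simp add: norm_mult) (meson le_less_trans mult_right_le_one_le norm_ge_zero)
    then show "(\<lambda>\<zeta>. w + u * \<zeta>) ` cball 0 1 \<subseteq> ball w s"
      by (auto simp: dist_norm)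
  qed (intro holomorphic_intros)
  then have G: "G holomorphic_on cball 0 1"
    by (simp add: G_def[abs_def] o_def)
  have "((\<lambda>\<zeta>. G \<zeta> / (\<zeta> - 0)) has_contour_integral (2 * of_real pi * \<i> * G 0)) (circlepath 0 1)"
    by (rule Cauchy_integral_circlepath_simple[OF G]) simp
  then have "((\<lambda>x. G (circlepath 0 1 x) / (circlepath 0 1 x - 0) *
      vector_derivative (circlepath 0 1) (at x within {0..1})) has_integral
      (2 * of_real pi * \<i> * G 0)) {0..1}"
    by (simp only: has_contour_integral_def)
  then have "((\<lambda>x. 2 * of_real pi * \<i> * G (e x)) has_integral (2 * of_real pi * \<i> * G 0)) {0..1}"
  proof (rule has_integral_eq[rotated])
    fix x :: real assume x: "x \<in> {0..1}"
    have "circlepath 0 1 x = e x"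
      by (simp add: circlepath e_def mult_ac)
    moreover have "vector_derivative (circlepath 0 1) (at x within {0..1}) = 2 * of_real pi * \<i> * e x"
      using x by (simp add: vector_derivative_circlepath01 e_def mult_ac)
    moreover have "e x \<noteq> 0" by (simp add: e_def)
    ultimately show "G (circlepath 0 1 x) / (circlepath 0 1 x - 0) *
        vector_derivative (circlepath 0 1) (at x within {0..1}) = 2 * of_real pi * \<i> * G (e x)"
      by simp
  qed
  then have "((\<lambda>x. 1 / (2 * of_real pi * \<i>) * (2 * of_real pi * \<i> * G (e x))) has_integral
      1 / (2 * of_real pi * \<i>) * (2 * of_real pi * \<i> * G 0)) {0..1}"
    by (rule has_integral_mult_right)
  then have int: "((\<lambda>x. G (e x)) has_integral G 0) {0..1}"
    by simp
  have "continuous_on {0..1} (\<lambda>x. G (e x))"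
    by (rule continuous_on_compose2[OF holomorphic_on_imp_continuous_on[OF G]])
       (auto simp: e1 e_def intro!: continuous_intros)
  then have c: "continuous_on {0..1} (\<lambda>x. norm (G (e x)))"
    by (intro continuous_intros)
  have "norm (G 0) \<le> integral {0..1} (\<lambda>x. norm (G (e x)))"
    using integral_norm_bound_integral[of "\<lambda>x. G (e x)" "{0..1}" "\<lambda>x. norm (G (e x))"]
      int integrable_continuous_interval[OF c]
    by (auto simp: has_integral_iff)
  then have "ennreal (norm (G 0)) \<le> ennreal (integral {0..1} (\<lambda>x. norm (G (e x))))"
    by (simp add: ennreal_leI)
  also have "\<dots> = (\<integral>\<^sup>+x. ennreal (norm (G (e x))) * indicator {0..1} x \<partial>lborel)"
    using integrable_integral[OF integrable_continuous_interval[OF c]]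
    by (intro nn_integral_has_integral_lebesgue'[symmetric]) auto
  finally show ?thesis by (simp add: G_def e_def)
qed

text \<open>Averaging the circle inequality over all radii needs no polar coordinates: by Tonelli and
  rotation invariance, each rotation \<open>u \<mapsto> u * e x\<close> contributes the same area integral.\<close>

lemma norm_le_area_mean:
  assumes holo: "F holomorphic_on ball w s"
  shows "ennreal (norm (F w)) * emeasure lborel (ball w s)
    \<le> (\<integral>\<^sup>+z\<in>ball w s. ennreal (norm (F z)) \<partial>lborel)"
proof -
  define e where "e x = exp (of_real (2 * pi * x) * \<i>)" for x
  have e1: "norm (e x) = 1" for x by (simp add: e_def)
  then have e0: "e x \<noteq> 0" for x by (metis norm_zero zero_neq_one)
  have [measurable]: "e \<in> borel_measurable borel"
    unfolding e_def by (intro borel_measurable_continuous_onI continuous_intros)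
  \<comment> \<open>The indicator makes \<open>G\<close> Borel on the whole plane, so that Tonelli
    applies to the double integral below.\<close>
  define G where "G z = ennreal (indicator (ball w s) z * norm (F z))" for z
  have [measurable]: "G \<in> borel_measurable borel"
  proof -
    have "continuous_on (ball w s) (\<lambda>z. norm (F z))"
      using holo by (intro continuous_intros holomorphic_on_imp_continuous_on)
    then show ?thesis
      unfolding G_def
      using borel_measurable_continuous_on_indicator[of "ball w s" "\<lambda>z. norm (F z)"] by simp
  qed
  have [measurable]: "ball (0::complex) s \<in> sets borel"
    by simp
  have in_ball: "w + u * e x \<in> ball w s \<longleftrightarrow> u \<in> ball 0 s" for u x
    by (simp add: dist_norm norm_mult e1)
  have rot: "(\<integral>\<^sup>+u\<in>ball 0 s. G (w + u * e x) \<partial>lborel) = (\<integral>\<^sup>+z\<in>ball w s. G z \<partial>lborel)" for x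
  proof -
    have im: "(\<lambda>u. w + u * e x) ` ball 0 s = ball w s"
    proof (intro equalityI subsetI)
      fix z assume z: "z \<in> ball w s"
      have "z = w + ((z - w) / e x) * e x" using e0 by simp
      then show "z \<in> (\<lambda>u. w + u * e x) ` ball 0 s"
        using z in_ball[of "(z - w) / e x" x] by (intro image_eqI[of _ _ "(z - w) / e x"]) metis+
    qed (use in_ball in auto)
    \<comment> \<open>The derivative is unimodular, so the Jacobian factor is 1.\<close>
    have "deriv (\<lambda>u. w + u * e x) u = e x" for u
      by (rule DERIV_imp_deriv) (auto intro!: derivative_eq_intros)
    then show ?thesis
      using nn_integral_holomorphic_substitution[of "ball 0 s" "\<lambda>u. w + u * e x" G] e0
      by (simp add: im e1 inj_on_def holomorphic_intros)
  qed
  have "emeasure lborel (ball w s) = emeasure lborel (ball (0::complex) s)"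
    by (cases "s > 0") (simp_all add: emeasure_ball ball_empty)
  then have "ennreal (norm (F w)) * emeasure lborel (ball w s)
      = (\<integral>\<^sup>+u\<in>ball (0::complex) s. ennreal (norm (F w)) \<partial>lborel)"
    by (simp add: nn_integral_cmult_indicator)
  also have "\<dots> \<le> (\<integral>\<^sup>+u\<in>ball 0 s. (\<integral>\<^sup>+x\<in>{0..1}. G (w + u * e x) \<partial>lborel) \<partial>lborel)"
  proof (intro nn_integral_mono)
    fix u :: complex
    show "ennreal (norm (F w)) * indicator (ball 0 s) u
      \<le> (\<integral>\<^sup>+x\<in>{0..1}. G (w + u * e x) \<partial>lborel) * indicator (ball 0 s) u"
    proof (cases "u \<in> ball 0 s")
      case True
      then have "G (w + u * e x) = ennreal (norm (F (w + u * e x)))" for x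
        using in_ball[of u x] by (simp add: G_def)
      then show ?thesis
        using norm_le_circle_mean[OF holo, of u] True by (simp add: e_def)
    qed simp
  qed
  also have "\<dots> = (\<integral>\<^sup>+u. (\<integral>\<^sup>+x. indicator (ball 0 s) u * (indicator {0..1} x * G (w + u * e x)) \<partial>lborel) \<partial>lborel)"
    by (intro nn_integral_cong) (auto simp: nn_integral_cmult[symmetric] mult_ac)
  also have "\<dots> = (\<integral>\<^sup>+x. (\<integral>\<^sup>+u. indicator (ball 0 s) u * (indicator {0..1} x * G (w + u * e x)) \<partial>lborel) \<partial>lborel)"
    by (rule lborel_pair.Fubini'[symmetric]) measurable
  also have "\<dots> = (\<integral>\<^sup>+x. indicator {0..1::real} x * (\<integral>\<^sup>+u\<in>ball 0 s. G (w + u * e x) \<partial>lborel) \<partial>lborel)"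
    by (intro nn_integral_cong) (auto simp: nn_integral_cmult[symmetric] mult_ac)
  also have "\<dots> = (\<integral>\<^sup>+z\<in>ball w s. G z \<partial>lborel)"
    unfolding rot by (simp add: nn_integral_multc)
  also have "\<dots> = (\<integral>\<^sup>+z\<in>ball w s. ennreal (norm (F z)) \<partial>lborel)"
    by (intro nn_integral_cong) (auto simp: G_def indicator_def)
  finally show ?thesis .
qed

text \<open>For \<open>p \<le> 1\<close> Jensen's inequality is not available. Instead evaluate the area mean at a maximum
  point \<open>w\<close> of \<open>(r - |z - w|)^(2/p) |F w|\<close>, on a disc of half the distance to the boundary: there
  \<open>|F| \<le> const * |F|^p\<close>, and the maximum \<open>M\<close> occurs on both sides, with exponents \<open>1\<close> and
  \<open>1 - p\<close>.\<close>

lemma powr_mean_bound_le_one: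
  assumes p: "0 < p" "p \<le> 1" and r: "0 < r" and holo: "F holomorphic_on cball z r"
    and I: "0 \<le> I" "(\<integral>\<^sup>+w\<in>ball z r. ennreal (norm (F w) powr p) \<partial>lborel) \<le> ennreal I"
  shows "norm (F z) powr p * r\<^sup>2 \<le> 2 powr (2 / p) / pi * I"
proof -
  have cont: "continuous_on (cball z r) F"
    using holo by (rule holomorphic_on_imp_continuous_on)
  \<comment> \<open>The exponent is chosen so that \<open>m z powr p\<close> is exactly the left
    side of the claim. Since \<open>m\<close> vanishes on the boundary circle, a positive maximum is
    attained inside.\<close>
  define m where "m w = (r - dist z w) powr (2 / p) * norm (F w)" for w
  have cm: "continuous_on (cball z r) m"
    unfolding m_def using p cont by (intro continuous_intros continuous_on_powr') auto
  obtain w where w: "w \<in> cball z r" and max: "\<And>v. v \<in> cball z r \<Longrightarrow> m v \<le> m w"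
    using continuous_attains_sup[OF compact_cball _ cm] r by auto
  have "m z powr p \<le> 2 powr (2 / p) / pi * I"
  proof (cases "m w > 0")
    case False
    then have "m z \<le> 0" using max[of z] r by auto
    moreover have "m z \<ge> 0" by (simp add: m_def)
    ultimately have "m z = 0" by (rule order_antisym)
    then show ?thesis using I(1) p by simp
  next
    case True
    \<comment> \<open>Half the distance from \<open>w\<close> to the circle: points of
      \<open>ball w s\<close> keep distance at least \<open>s\<close> from it, and comparison with
      the maximum then bounds \<open>F\<close> on that ball.\<close>
    define s where "s = (r - dist z w) / 2"
    define M where "M = m w"
    have "r - dist z w \<noteq> 0" using True by (auto simp: m_def)
    then have s: "s > 0" using w by (simp add: s_def)
    have "2 * s = r - dist z w" by (simp add: s_def)
    then have M: "M > 0" "M = (2 * s) powr (2 / p) * norm (F w)"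
      using True by (simp_all add: M_def m_def \<open>2 * s = r - dist z w\<close>)
    have sub: "ball w s \<subseteq> ball z r"
    proof
      fix v assume "v \<in> ball w s"
      then have "dist z v < dist z w + s" using dist_triangle[of z v w] by simp
      then show "v \<in> ball z r" using s by (simp add: s_def field_simps)
    qed
    have bnd: "norm (F v) \<le> M * s powr (- (2 / p))" if "v \<in> ball w s" for v
    proof -
      have "dist z v < dist z w + s" using dist_triangle[of z v w] that by simp
      then have "s \<le> r - dist z v" by (simp add: s_def field_simps)
      then have "s powr (2 / p) * norm (F v) \<le> m v"
        unfolding m_def using s p by (intro mult_right_mono powr_mono2) auto
      also have "m v \<le> M" using max[of v] sub that by (auto simp: M_def)
      finally show ?thesis using s by (simp add: powr_minus field_simps)
    qed
    \<comment> \<open>\<open>|F|\<close> is split as \<open>|F| powr (1 - p)\<close> times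
      \<open>|F| powr p\<close>, and the first factor is replaced by its upper bound; this uses
      \<open>p \<le> 1\<close>.\<close>
    define T where "T = (M * s powr (- (2 / p))) powr (1 - p)"
    have T0: "T \<ge> 0" by (simp add: T_def)
    have split: "norm (F v) \<le> T * norm (F v) powr p" if "v \<in> ball w s" for v
    proof (cases "F v = 0")
      case False
      have "norm (F v) = norm (F v) powr (1 - p) * norm (F v) powr p"
        using False by (simp add: powr_add[symmetric])
      also have "\<dots> \<le> T * norm (F v) powr p"
        unfolding T_def using bnd[OF that] p by (intro mult_right_mono powr_mono2) auto
      finally show ?thesis .
    qed (use T0 p in auto)
    have F_meas: "(\<lambda>v. ennreal (norm (F v) powr p) * indicator (ball w s) v) \<in> borel_measurable lborel"
    proof -
      have "continuous_on (ball w s) F"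
        by (rule continuous_on_subset[OF cont]) (use sub in auto)
      then have "continuous_on (ball w s) (\<lambda>v. norm (F v) powr p)"
        using p by (intro continuous_on_powr' continuous_intros)
          auto
      then have "(\<lambda>v. ennreal (indicator (ball w s) v * norm (F v) powr p)) \<in> borel_measurable lborel"
        using borel_measurable_continuous_on_indicator[of "ball w s" "\<lambda>v. norm (F v) powr p"] by simp
      then show ?thesis
        by (rule measurable_cong[THEN iffD1, rotated]) (auto simp: indicator_def)
    qed
    have "F holomorphic_on ball w s"
      using holo by (rule holomorphic_on_subset) (use sub in auto)
    then have "ennreal (norm (F w)) * emeasure lborel (ball w s)
        \<le> (\<integral>\<^sup>+v\<in>ball w s. ennreal (norm (F v)) \<partial>lborel)"
      by (rule norm_le_area_mean)
    also have "\<dots> \<le> (\<integral>\<^sup>+v. ennreal T * (ennreal (norm (F v) powr p) * indicator (ball w s) v) \<partial>lborel)"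
      using split T0 by (intro nn_integral_mono)
        (auto simp: indicator_def ennreal_mult'[symmetric] intro!: ennreal_leI)
    also have "\<dots> = ennreal T * (\<integral>\<^sup>+v\<in>ball w s. ennreal (norm (F v) powr p) \<partial>lborel)"
      by (rule nn_integral_cmult[OF F_meas])
    also have "\<dots> \<le> ennreal T * (\<integral>\<^sup>+v\<in>ball z r. ennreal (norm (F v) powr p) \<partial>lborel)"
      using sub by (intro mult_left_mono nn_integral_mono) (auto simp: indicator_def)
    also have "\<dots> \<le> ennreal T * ennreal I"
      using I(2) by (intro mult_left_mono) auto
    finally have "norm (F w) * (pi * s\<^sup>2) \<le> T * I"
      using s T0 I(1) by (simp add: emeasure_ball unit_ball_vol_2 ennreal_mult'[symmetric] ennreal_le_iff)
    \<comment> \<open>This factor balances the powers of \<open>s\<close>: \<open>T\<close> carries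
      \<open>s powr (2 - 2 / p)\<close>, so the right side becomes free of \<open>s\<close>, while
      the left side becomes a constant multiple of \<open>M\<close>.\<close>
    then have "norm (F w) * (pi * s\<^sup>2) * (s powr (2 / p) * s powr (-2)) \<le> T * I * (s powr (2 / p) * s powr (-2))"
      by (intro mult_right_mono) auto
    moreover have s2: "s\<^sup>2 * s powr (-2) = 1"
      using s by (simp add: powr_neg_numeral)
    moreover have "T * s powr (2 / p) * s powr (-2) = M powr (1 - p)"
    proof -
      have "T = M powr (1 - p) * s powr (- (2 / p) * (1 - p))"
        using M s by (simp only: T_def powr_mult powr_powr powr_ge_zero less_imp_le)
      then have "T * s powr (2 / p) * s powr (-2) = M powr (1 - p) *
          s powr (- (2 / p) * (1 - p) + 2 / p + - 2)"
        by (simp only: powr_add mult.assoc)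
      also have "- (2 / p) * (1 - p) + 2 / p + - 2 = 0" using p by (simp add: field_simps)
      finally show ?thesis using s by simp
    qed
    moreover have "norm (F w) * (pi * s\<^sup>2) * (s powr (2 / p) * s powr (-2))
        = pi * (norm (F w) * s powr (2 / p)) * (s\<^sup>2 * s powr (-2))"
      "T * I * (s powr (2 / p) * s powr (-2)) = T * s powr (2 / p) * s powr (-2) * I"
      by (simp_all only: mult_ac)
    ultimately have "pi * (norm (F w) * s powr (2 / p)) \<le> M powr (1 - p) * I"
      by (simp only: mult_1_right)
    \<comment> \<open>Origin of the constant: \<open>2 powr (2 / p)\<close> arises because
      \<open>M\<close> is measured with the full distance \<open>2 * s\<close>, and
      \<open>pi\<close> is the area factor of the smaller disc.\<close>
    moreover have "M = 2 powr (2 / p) * (norm (F w) * s powr (2 / p))"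
      using M(2) s by (simp add: powr_mult)
    ultimately have "pi * M \<le> 2 powr (2 / p) * (M powr (1 - p) * I)"
      by (simp add: mult_ac)
    moreover have "M = M powr p * M powr (1 - p)"
      using M by (simp add: powr_add[symmetric])
    ultimately have "M powr (1 - p) * (pi * M powr p) \<le> M powr (1 - p) * (2 powr (2 / p) * I)"
      by (metis mult.assoc mult.commute)
    then have "pi * M powr p \<le> 2 powr (2 / p) * I"
      by (rule mult_left_le_imp_le) (use M(1) in simp)
    then have "M powr p \<le> 2 powr (2 / p) / pi * I"
      by (simp add: pos_le_divide_eq mult.commute)
    moreover have "m z powr p \<le> M powr p"
      using max[of z] r p by (intro powr_mono2) (auto simp: M_def m_def)
    ultimately show ?thesis by linarith
  qed
  moreover have "m z powr p = norm (F z) powr p * r\<^sup>2"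
    using r p by (simp add: m_def powr_mult powr_powr mult.commute)
  ultimately show ?thesis by simp
qed

text \<open>Larger exponents reduce to the previous case, applied to \<open>F ^ n\<close> and \<open>p / n \<le> 1\<close>.\<close>

lemma powr_mean_bound:
  assumes p: "0 < p"
  obtains C where "0 < C"
    "\<And>F z r I. \<lbrakk>0 < r; F holomorphic_on cball z r; 0 \<le> I;
        (\<integral>\<^sup>+w\<in>ball z r. ennreal (norm (F w) powr p) \<partial>lborel) \<le> ennreal I\<rbrakk>
      \<Longrightarrow> norm (F z) powr p * r\<^sup>2 \<le> C * I"
proof -
  obtain n :: nat where n: "n > 0" "p \<le> real n"
    by (metis gr0I less_eq_real_def not_less of_nat_0 p real_arch_simple)
  have pw: "norm (F w ^ n) powr (p / n) = norm (F w) powr p" for F :: "complex \<Rightarrow> complex" and w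
    using n by (cases "F w = 0") (auto simp: norm_power powr_realpow[symmetric] powr_powr)
  show thesis
  proof
    show "0 < 2 powr (2 / (p / n)) / pi" by simp
    fix F :: "complex \<Rightarrow> complex" and z r I
    assume "0 < r" "F holomorphic_on cball z r" "0 \<le> (I::real)"
      "(\<integral>\<^sup>+w\<in>ball z r. ennreal (norm (F w) powr p) \<partial>lborel) \<le> ennreal I"
    then show "norm (F z) powr p * r\<^sup>2 \<le> 2 powr (2 / (p / n)) / pi * I"
      using powr_mean_bound_le_one[of "p / n" r "\<lambda>w. F w ^ n" z I] n p
      by (simp add: pw holomorphic_on_power)
  qed
qed

section \<open>Pointwise growth in weighted spaces on the disk\<close>

lemma nn_integral_disk_measure:
  assumes "continuous_on (ball 0 1) f" "\<And>z. z \<in> ball 0 1 \<Longrightarrow> 0 \<le> f z"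
  shows "(\<integral>\<^sup>+z. ennreal (f z) \<partial>disk_measure \<beta>)
    = (\<integral>\<^sup>+z\<in>ball 0 1. ennreal (f z * (1 - (norm z)\<^sup>2) powr \<beta> / pi) \<partial>lborel)"
proof -
  have [measurable]: "f \<in> borel_measurable (restrict_space lborel (ball 0 1))"
    using borel_measurable_continuous_on_restrict[OF assms(1)]
    by (simp cong: measurable_cong_sets add: sets_restrict_space)
  have [measurable]: "(\<lambda>z::complex. (1 - (norm z)\<^sup>2) powr \<beta> / pi) \<in> borel_measurable (restrict_space lborel (ball 0 1))"
    by (rule measurable_restrict_space1) measurable
  have "(\<integral>\<^sup>+z. ennreal (f z) \<partial>disk_measure \<beta>)
    = (\<integral>\<^sup>+z. ennreal ((1 - (norm z)\<^sup>2) powr \<beta> / pi) * ennreal (f z) \<partial>restrict_space lborel (ball 0 1))"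
    unfolding disk_measure_def by (rule nn_integral_density) measurable
  also have "\<dots> = (\<integral>\<^sup>+z\<in>ball 0 1. (ennreal ((1 - (norm z)\<^sup>2) powr \<beta> / pi) * ennreal (f z)) \<partial>lborel)"
    by (rule nn_integral_restrict_space) simp
  also have "\<dots> = (\<integral>\<^sup>+z\<in>ball 0 1. ennreal (f z * (1 - (norm z)\<^sup>2) powr \<beta> / pi) \<partial>lborel)"
    using assms(2) by (intro nn_integral_cong)
      (auto simp: indicator_def ennreal_mult''[symmetric] mult_ac)
  finally show ?thesis .
qed

lemma borel_measurable_disk_measure:
  fixes f :: "complex \<Rightarrow> 'b::topological_space"
  assumes "continuous_on (ball 0 1) f"
  shows "f \<in> borel_measurable (disk_measure \<beta>)"
  unfolding disk_measure_def
  using borel_measurable_continuous_on_restrict[OF assms]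
  by (simp cong: measurable_cong_sets add: sets_restrict_space)

lemma AE_disk_measure_imp:
  assumes "\<And>z. z \<in> ball 0 1 \<Longrightarrow> P z"
  shows "AE z in disk_measure \<beta>. P z"
  using assms by (intro AE_I2) (auto simp: disk_measure_def space_restrict_space)

lemma one_minus_norm_power2_bounds:
  assumes "z \<in> ball (0::complex) 1"
  shows "0 < 1 - (norm z)\<^sup>2" "1 - norm z \<le> 1 - (norm z)\<^sup>2" "1 - (norm z)\<^sup>2 \<le> 2 * (1 - norm z)"
proof -
  have n: "0 \<le> norm z" "norm z < 1" using assms by auto
  then show "0 < 1 - (norm z)\<^sup>2" by (simp add: power_less_one_iff)
  have "(norm z)\<^sup>2 \<le> norm z * 1" unfolding power2_eq_square using n by (intro mult_left_mono) auto
  then show "1 - norm z \<le> 1 - (norm z)\<^sup>2" by simp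
  have "0 \<le> (1 - norm z)\<^sup>2" by simp
  then show "1 - (norm z)\<^sup>2 \<le> 2 * (1 - norm z)" by (simp add: power2_diff)
qed

text \<open>Passes from comparable bases to comparable weights; the absolute value lets one constant
  serve exponents of either sign, as \<open>\<alpha>\<close> may be negative.\<close>

lemma powr_le_powr_abs_ratio:
  fixes x y :: real
  assumes "0 < x" "0 < y" "x \<le> 4 * y" "y \<le> 4 * x"
  shows "x powr a \<le> 4 powr \<bar>a\<bar> * y powr a"
proof (cases "a \<ge> 0")
  case True
  then have "x powr a \<le> (4 * y) powr a" using assms by (intro powr_mono2) auto
  then show ?thesis using True assms by (simp add: powr_mult)
next
  case False
  then have "x powr a \<le> (y / 4) powr a" using assms by (intro powr_mono2') auto
  also have "(y / 4) powr a = 4 powr \<bar>a\<bar> * y powr a"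
    using False assms by (simp add: powr_divide powr_minus field_simps)
  finally show ?thesis .
qed

text \<open>\<open>C\<close> is fixed before \<open>F\<close>, so with \<open>F = deriv f\<close>
  this gives one majorant for the whole unit ball. The free bound \<open>I\<close> also covers
  functions of arbitrary norm.\<close>

lemma disk_pointwise_growth:
  assumes p: "0 < p"
  obtains C where "0 < C"
    "\<And>F I z. \<lbrakk>F holomorphic_on ball 0 1; 0 \<le> I; z \<in> ball 0 1;
        (\<integral>\<^sup>+w. ennreal (norm (F w) powr p) \<partial>disk_measure \<alpha>) \<le> ennreal I\<rbrakk>
      \<Longrightarrow> norm (F z) powr p * (1 - (norm z)\<^sup>2) powr (\<alpha> + 2) \<le> C * I"
proof -
  obtain C where C: "0 < C"
    and Cb: "\<And>F z r I. \<lbrakk>0 < r; F holomorphic_on cball z r; 0 \<le> I;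
        (\<integral>\<^sup>+w\<in>ball z r. ennreal (norm (F w) powr p) \<partial>lborel) \<le> ennreal I\<rbrakk>
      \<Longrightarrow> norm (F z) powr p * r\<^sup>2 \<le> C * I"
    using powr_mean_bound[OF p] by blast
  \<comment> \<open>The power of 4 compares the weights at two nearby points, and \<open>pi\<close>
    undoes the normalisation of the area measure.\<close>
  define K where "K = 4 powr \<bar>\<alpha>\<bar> * pi"
  have K: "K > 0" by (simp add: K_def)
  show thesis
  proof
    show "0 < 16 * C * K" using C K by simp
    fix F :: "complex \<Rightarrow> complex" and I z
    assume F: "F holomorphic_on ball 0 1" and I: "0 \<le> I" and z: "z \<in> ball (0::complex) 1"
      and le: "(\<integral>\<^sup>+w. ennreal (norm (F w) powr p) \<partial>disk_measure \<alpha>) \<le> ennreal I"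
    define r where "r = (1 - norm z) / 2"
    define \<delta> where "\<delta> z = 1 - (norm z)\<^sup>2" for z :: complex
    have r: "r > 0" using z by (simp add: r_def)
    have \<delta>z: "\<delta> z > 0" "\<delta> z \<le> 4 * r"
      using one_minus_norm_power2_bounds[OF z] by (auto simp: \<delta>_def r_def)
    have cb: "norm w \<le> norm z + r \<and> norm z - r \<le> norm w" if "w \<in> cball z r" for w
    proof -
      have "norm (w - z) \<le> r" using that by (simp add: dist_norm norm_minus_commute)
      moreover have "norm w \<le> norm z + norm (w - z)" using norm_triangle_ineq[of z "w - z"] by simp
      moreover have "norm z \<le> norm w + norm (w - z)"
        using norm_triangle_ineq[of w "z - w"] by (simp add: norm_minus_commute)
      ultimately show ?thesis by linarith
    qed
    have sub: "cball z r \<subseteq> ball 0 1"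
    proof
      fix w assume "w \<in> cball z r"
      then have "norm w \<le> norm z + r" using cb by blast
      then show "w \<in> ball 0 1" using z by (simp add: r_def field_simps)
    qed
    have weight: "1 \<le> K * \<delta> z powr (- \<alpha>) * (\<delta> w powr \<alpha> / pi)" if w: "w \<in> ball z r" for w
    proof -
      have "w \<in> cball z r" using w by auto
      then have wb: "w \<in> ball 0 1" "norm w \<le> norm z + r" "norm z - r \<le> norm w"
        using sub cb by auto
      note b = one_minus_norm_power2_bounds[OF wb(1)] one_minus_norm_power2_bounds[OF z]
      \<comment> \<open>Both ratios are at most 4: \<open>1 - norm w\<close> lies between 1/2 and
        3/2 of \<open>1 - norm z\<close>, and replacing \<open>1 - norm\<close> by
        \<open>\<delta>\<close> costs at most a factor 2.\<close>
      have "\<delta> z powr \<alpha> \<le> 4 powr \<bar>\<alpha>\<bar> * \<delta> w powr \<alpha>"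
        using b wb(2,3) by (intro powr_le_powr_abs_ratio) (auto simp: \<delta>_def r_def field_simps)
      then have "\<delta> z powr \<alpha> * \<delta> z powr (- \<alpha>) \<le> 4 powr \<bar>\<alpha>\<bar> * \<delta> w powr \<alpha> * \<delta> z powr (- \<alpha>)"
        by (intro mult_right_mono) auto
      then show ?thesis using \<delta>z by (simp add: K_def powr_add[symmetric] mult_ac)
    qed
    have cont: "continuous_on (ball 0 1) (\<lambda>w. norm (F w) powr p)"
      using F p by (intro continuous_on_powr' continuous_intros holomorphic_on_imp_continuous_on) auto
    define J where "J w = ennreal (norm (F w) powr p * \<delta> w powr \<alpha> / pi) * indicator (ball 0 1) w" for w
    have J_meas [measurable]: "J \<in> borel_measurable borel"
    proof -
      have "continuous_on (ball 0 1) (\<lambda>w. norm (F w) powr p * \<delta> w powr \<alpha> / pi)"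
      proof -
        have "continuous_on (ball 0 1) (\<lambda>w. \<delta> w powr \<alpha>)"
          unfolding \<delta>_def
          by (intro continuous_on_powr continuous_intros) (use one_minus_norm_power2_bounds(1) in force)
        then show ?thesis
          using cont by (intro continuous_on_divide continuous_on_mult continuous_on_const) auto
      qed
      then have "(\<lambda>w. ennreal (indicator (ball 0 1) w * (norm (F w) powr p * \<delta> w powr \<alpha> / pi))) \<in> borel_measurable borel"
        using borel_measurable_continuous_on_indicator[of "ball 0 1" "\<lambda>w. norm (F w) powr p * \<delta> w powr \<alpha> / pi"]
        by simp
      then show ?thesis
        by (rule measurable_cong[THEN iffD1, rotated]) (auto simp: indicator_def J_def)
    qed
    have "(\<integral>\<^sup>+w\<in>ball z r. ennreal (norm (F w) powr p) \<partial>lborel)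
        \<le> (\<integral>\<^sup>+w. ennreal (K * \<delta> z powr (- \<alpha>)) * J w \<partial>lborel)"
    proof (intro nn_integral_mono)
      fix w
      show "ennreal (norm (F w) powr p) * indicator (ball z r) w \<le> ennreal (K * \<delta> z powr (- \<alpha>)) * J w"
      proof (cases "w \<in> ball z r")
        case True
        then have "w \<in> cball z r" by auto
        then have "w \<in> ball 0 1" using sub by blast
        moreover have "norm (F w) powr p * 1 \<le> norm (F w) powr p * (K * \<delta> z powr (- \<alpha>) * (\<delta> w powr \<alpha> / pi))"
          using weight[OF True] by (intro mult_left_mono) auto
        ultimately show ?thesis
          using True K by (simp add: J_def ennreal_mult'[symmetric] mult_ac ennreal_leI)
      qed simp
    qed
    also have "\<dots> = ennreal (K * \<delta> z powr (- \<alpha>)) * (\<integral>\<^sup>+w. J w \<partial>lborel)"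
      by (rule nn_integral_cmult) measurable
    also have "\<dots> \<le> ennreal (K * \<delta> z powr (- \<alpha>)) * ennreal I"
      using le by (intro mult_left_mono)
        (simp_all add: nn_integral_disk_measure[OF cont] J_def \<delta>_def)
    finally have "(\<integral>\<^sup>+w\<in>ball z r. ennreal (norm (F w) powr p) \<partial>lborel) \<le> ennreal (K * \<delta> z powr (- \<alpha>) * I)"
      using K I by (simp add: ennreal_mult'[symmetric])
    then have "norm (F z) powr p * r\<^sup>2 \<le> C * (K * \<delta> z powr (- \<alpha>) * I)"
      using K I F sub by (intro Cb r) (auto intro: holomorphic_on_subset)
    \<comment> \<open>The 16 anticipates the square of \<open>4 * r\<close>, which dominates
      \<open>\<delta> z\<close>.\<close>
    then have "norm (F z) powr p * r\<^sup>2 * (16 * \<delta> z powr \<alpha>) \<le> C * (K * \<delta> z powr (- \<alpha>) * I) * (16 * \<delta> z powr \<alpha>)"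
      by (intro mult_right_mono) auto
    also have "\<dots> = 16 * C * K * I * (\<delta> z powr (- \<alpha>) * \<delta> z powr \<alpha>)"
      by (simp only: mult_ac)
    also have "\<delta> z powr (- \<alpha>) * \<delta> z powr \<alpha> = 1"
      using \<delta>z by (simp add: powr_add[symmetric])
    finally have 1: "norm (F z) powr p * r\<^sup>2 * (16 * \<delta> z powr \<alpha>) \<le> 16 * C * K * I"
      by simp
    have "\<delta> z powr (\<alpha> + 2) = (\<delta> z)\<^sup>2 * \<delta> z powr \<alpha>"
      using \<delta>z by (simp add: powr_add)
    also have "\<dots> \<le> (4 * r)\<^sup>2 * \<delta> z powr \<alpha>"
      using \<delta>z by (intro mult_right_mono power_mono) auto
    finally have "norm (F z) powr p * \<delta> z powr (\<alpha> + 2) \<le> norm (F z) powr p * ((4 * r)\<^sup>2 * \<delta> z powr \<alpha>)"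
      by (intro mult_left_mono) auto
    with 1 show "norm (F z) powr p * (1 - (norm z)\<^sup>2) powr (\<alpha> + 2) \<le> 16 * C * K * I"
      by (simp add: \<delta>_def power_mult_distrib mult_ac)
  qed
qed

text \<open>For \<open>\<alpha> < 0\<close> the boundary layers
  \<open>1 - |z|^2 \<le> 2^(-k)\<close> have area exactly \<open>pi * 2^(-k)\<close>, so a dyadic
  decomposition replaces polar coordinates. The resulting geometric series has ratio
  \<open>2 powr (-(\<alpha> + 1))\<close>, below 1 because \<open>\<alpha> > -1\<close>. The finite
  total mass is what normalises the extremal functions.\<close>

lemma nn_integral_disk_weight_finite:
  assumes \<alpha>: "\<alpha> > -1"
  shows "(\<integral>\<^sup>+z\<in>ball (0::complex) 1. ennreal ((1 - (norm z)\<^sup>2) powr \<alpha>) \<partial>lborel) < \<infinity>"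
proof (cases "\<alpha> \<ge> 0")
  case True
  have "(\<integral>\<^sup>+z\<in>ball (0::complex) 1. ennreal ((1 - (norm z)\<^sup>2) powr \<alpha>) \<partial>lborel)
      \<le> (\<integral>\<^sup>+z\<in>ball (0::complex) 1. 1 \<partial>lborel)"
    using True by (intro nn_integral_mono) (auto simp: indicator_def power_le_one intro!: powr_le1)
  also have "\<dots> < \<infinity>" by (simp add: emeasure_ball)
  finally show ?thesis .
next
  case False
  define A where "A k = {z \<in> ball (0::complex) 1. 1 - (norm z)\<^sup>2 \<le> (1/2) ^ k}" for k
  have A_eq: "A k = ball 0 1 - ball 0 (sqrt (1 - (1/2) ^ k))" for k
  proof -
    have "1 - (norm z)\<^sup>2 \<le> (1/2) ^ k \<longleftrightarrow> sqrt (1 - (1/2) ^ k) \<le> norm z" for z :: complex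
    proof -
      have "sqrt (1 - (1/2) ^ k) \<le> norm z \<longleftrightarrow> 1 - (1/2) ^ k \<le> (norm z)\<^sup>2"
        using real_sqrt_le_iff[of "1 - (1/2) ^ k" "(norm z)\<^sup>2"] by simp
      then show ?thesis by linarith
    qed
    then have "A k = {z \<in> ball 0 1. sqrt (1 - (1/2) ^ k) \<le> norm z}"
      unfolding A_def by (intro Collect_cong conj_cong refl)
    also have "\<dots> = ball 0 1 - ball 0 (sqrt (1 - (1/2) ^ k))"
      by (simp add: set_eq_iff not_less)
    finally show ?thesis .
  qed
  have A_sets [measurable]: "A k \<in> sets borel" for k
    unfolding A_eq by auto
  have half: "0 \<le> 1 - (1/2::real) ^ k" "(1/2::real) ^ k \<le> 1" for k
    by (auto simp: power_le_one)
  have A_measure: "emeasure lborel (A k) = ennreal (pi * (1/2) ^ k)" for k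
  proof -
    have "emeasure lborel (A k) = emeasure lborel (ball (0::complex) 1) - emeasure lborel (ball (0::complex) (sqrt (1 - (1/2) ^ k)))"
      unfolding A_eq using half[of k]
      by (intro emeasure_Diff subset_ball) (auto simp: emeasure_ball)
    also have "\<dots> = ennreal (pi - pi * (1 - (1/2) ^ k))"
      using half[of k] by (simp add: emeasure_ball unit_ball_vol_2 ennreal_minus)
    finally show ?thesis by (simp add: algebra_simps)
  qed
  have single_le: "f k \<le> suminf f" for f :: "nat \<Rightarrow> ennreal" and k
    using sum_le_suminf[of f "{k}"] by simp
  \<comment> \<open>The nested sets \<open>A k\<close> stand in for disjoint shells: overcounting
    only enlarges the sum, and a single term already dominates.\<close>
  have bound: "ennreal ((1 - (norm z)\<^sup>2) powr \<alpha>) * indicator (ball 0 1) z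
      \<le> (\<Sum>k. ennreal (((1/2) ^ Suc k) powr \<alpha>) * indicator (A k) z)" for z :: complex
  proof (cases "z \<in> ball 0 1")
    case True
    define t where "t = 1 - (norm z)\<^sup>2"
    have t: "0 < t" "t \<le> 1"
      using one_minus_norm_power2_bounds(1)[OF True] by (auto simp: t_def)
    obtain n where n: "(1/2::real) ^ n < t"
      using real_arch_pow_inv[of t "1/2"] t by auto
    \<comment> \<open>Minimality gives \<open>2^(-m) < t \<le> 2^(-(m - 1))\<close>, where
      \<open>m\<close> is positive because \<open>t \<le> 1\<close>. As \<open>\<alpha>\<close> is
      negative here, the lower end of this interval bounds the weight.\<close>
    define m where "m = (LEAST n. (1/2::real) ^ n < t)"
    have m: "(1/2::real) ^ m < t"
      unfolding m_def by (rule LeastI[of "\<lambda>n. (1/2::real) ^ n < t", OF n])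
    have below: "t \<le> (1/2) ^ j" if "j < m" for j
      using not_less_Least[OF that[unfolded m_def]] by (simp only: not_less)
    from m have "m \<noteq> 0" using t by (auto intro: Nat.gr0I)
    then obtain k where k: "m = Suc k" using not0_implies_Suc by blast
    have "z \<in> A k" using below[of k] True k by (simp add: A_def t_def)
    have "t powr \<alpha> \<le> ((1/2) ^ Suc k) powr \<alpha>"
      using m k False t by (intro powr_mono2') auto
    then have "ennreal (t powr \<alpha>) \<le> ennreal (((1/2) ^ Suc k) powr \<alpha>) * indicator (A k) z"
      using \<open>z \<in> A k\<close> by (simp add: ennreal_leI)
    also have "\<dots> \<le> (\<Sum>k. ennreal (((1/2) ^ Suc k) powr \<alpha>) * indicator (A k) z)"
      by (rule single_le[of "\<lambda>k. ennreal (((1/2) ^ Suc k) powr \<alpha>) * indicator (A k) z"])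
    finally show ?thesis using True by (simp add: t_def)
  qed simp
  define q :: real where "q = (1/2) powr (\<alpha> + 1)"
  have q: "0 < q" "q < 1"
    using \<alpha> by (auto simp: q_def powr01_less_one)
  have term_eq: "((1/2::real) ^ Suc k) powr \<alpha> * (pi * (1/2) ^ k) = 2 * pi * q * q ^ k" for k
  proof -
    have "((1/2::real) ^ Suc k) powr \<alpha> * (1/2) ^ Suc k = ((1/2::real) ^ Suc k) powr (\<alpha> + 1)"
      by (simp add: powr_add)
    also have "\<dots> = (1/2) powr (real (Suc k) * (\<alpha> + 1))"
      unfolding powr_powr[symmetric] by (subst powr_realpow) simp_all
    also have "\<dots> = q ^ Suc k"
      unfolding q_def by (subst powr_power) (auto simp: mult.commute)
    finally show ?thesis by (simp add: field_simps)
  qed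
  have "(\<integral>\<^sup>+z\<in>ball (0::complex) 1. ennreal ((1 - (norm z)\<^sup>2) powr \<alpha>) \<partial>lborel)
      \<le> (\<integral>\<^sup>+z. (\<Sum>k. ennreal (((1/2) ^ Suc k) powr \<alpha>) * indicator (A k) z) \<partial>lborel)"
    by (intro nn_integral_mono bound)
  also have "\<dots> = (\<Sum>k. ennreal (((1/2) ^ Suc k) powr \<alpha>) * emeasure lborel (A k))"
    by (subst nn_integral_suminf) (auto simp: nn_integral_cmult_indicator)
  also have "\<dots> = (\<Sum>k. ennreal (2 * pi * q * q ^ k))"
    unfolding A_measure by (subst ennreal_mult'[symmetric], simp) (simp only: term_eq)
  also have "\<dots> = ennreal (\<Sum>k. 2 * pi * q * q ^ k)"
    using q by (intro suminf_ennreal2) (auto intro!: summable_mult summable_geometric)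
  also have "\<dots> < \<infinity>" by simp
  finally show ?thesis .
qed

section \<open>Extremal functions\<close>

lemma dirichlet_space_cont_deriv:
  assumes "f holomorphic_on ball 0 1" "0 < p"
  shows "continuous_on (ball 0 1) (\<lambda>z. norm (deriv f z) powr p)"
proof -
  have "continuous_on (ball 0 1) (deriv f)"
    using assms(1) by (intro holomorphic_on_imp_continuous_on holomorphic_deriv) auto
  then show ?thesis
    using assms(2) by (intro continuous_on_powr' continuous_intros) auto
qed

text \<open>Membership makes the integrand integrable, so the Bochner integral inside
  \<open>dirichlet_norm\<close> is the true integral and not the default value 0.\<close>

lemma dirichlet_nn_integral_eq:
  assumes f: "f \<in> dirichlet_space p \<alpha>" and p: "0 < p"
  shows "(\<integral>\<^sup>+z. ennreal (norm (deriv f z) powr p) \<partial>disk_measure \<alpha>)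
    = ennreal (\<integral>z. norm (deriv f z) powr p \<partial>disk_measure \<alpha>)"
proof (rule nn_integral_eq_integral)
  have "f holomorphic_on ball 0 1" and fin: "(\<integral>\<^sup>+z. ennreal (norm (deriv f z) powr p) \<partial>disk_measure \<alpha>) < \<infinity>"
    using f by (auto simp: dirichlet_space_def)
  then show "integrable (disk_measure \<alpha>) (\<lambda>z. norm (deriv f z) powr p)"
    by (intro integrableI_nonneg borel_measurable_disk_measure dirichlet_space_cont_deriv p) auto
qed auto

text \<open>The disk is convex, so \<open>f' g\<close> has a primitive \<open>G\<close> there, and
  the integral along the segment from 0 is \<open>G z - G 0\<close>. Agreement on the open disk
  suffices to transfer the derivative.\<close>

lemma S_op_holomorphic_deriv:
  assumes f: "f holomorphic_on ball 0 1" and g: "g holomorphic_on ball 0 1"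
  shows "S_op g f holomorphic_on ball 0 1"
    and "z \<in> ball 0 1 \<Longrightarrow> deriv (S_op g f) z = deriv f z * g z"
proof -
  have "(\<lambda>w. deriv f w * g w) holomorphic_on ball 0 1"
    using f g by (intro holomorphic_intros) auto
  then obtain G where G: "\<And>x. x \<in> ball 0 1 \<Longrightarrow> (G has_field_derivative (deriv f x * g x)) (at x within ball 0 1)"
    using holomorphic_convex_primitive'[of "ball 0 1" "\<lambda>w. deriv f w * g w"] by auto
  have S: "S_op g f x = G x - G 0" if "x \<in> ball 0 1" for x
  proof -
    have "closed_segment 0 x \<subseteq> ball 0 1"
      using that by (intro closed_segment_subset) auto
    then have "((\<lambda>w. deriv f w * g w) has_contour_integral
        (G (pathfinish (linepath 0 x)) - G (pathstart (linepath 0 x)))) (linepath 0 x)"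
      by (intro contour_integral_primitive[OF G]) auto
    then show ?thesis
      unfolding S_op_def by (simp add: contour_integral_unique)
  qed
  have der: "(S_op g f has_field_derivative (deriv f x * g x)) (at x)" if x: "x \<in> ball 0 1" for x
  proof -
    have "(G has_field_derivative (deriv f x * g x)) (at x)"
      using G[OF x] by (simp only: at_within_open[OF x open_ball])
    then have "((\<lambda>x. G x - G 0) has_field_derivative (deriv f x * g x)) (at x)"
      using DERIV_diff[OF _ DERIV_const] by fastforce
    then show ?thesis
      by (rule has_field_derivative_transform_within_open[of _ _ _ "ball 0 1"]) (use x S in auto)
  qed
  then show "S_op g f holomorphic_on ball 0 1"
    unfolding holomorphic_on_open[OF open_ball] by blast
  show "z \<in> ball 0 1 \<Longrightarrow> deriv (S_op g f) z = deriv f z * g z"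
    using der by (rule DERIV_imp_deriv)
qed

section \<open>Automorphisms of the unit disk\<close>

lemma disk_denominator:
  fixes a z :: complex
  assumes "a \<in> ball 0 1" "z \<in> ball 0 1"
  shows "0 < Re (1 - cnj a * z)" "1 - cnj a * z \<noteq> 0"
proof -
  have "norm (cnj a * z) < 1"
    using assms mult_strict_mono'[of "norm a" 1 "norm z" 1] by (simp add: norm_mult)
  then show "0 < Re (1 - cnj a * z)"
    using complex_Re_le_cmod[of "cnj a * z"] by simp
  then show "1 - cnj a * z \<noteq> 0" by (metis less_irrefl zero_complex.sel(1))
qed

lemma disk_automorphism_norm:
  fixes a z :: complex
  assumes "a \<in> ball 0 1" "z \<in> ball 0 1"
  shows "1 - (norm ((a - z) / (1 - cnj a * z)))\<^sup>2
    = (1 - (norm a)\<^sup>2) * (1 - (norm z)\<^sup>2) / (norm (1 - cnj a * z))\<^sup>2"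
proof -
  have "(norm (1 - cnj a * z))\<^sup>2 - (norm (a - z))\<^sup>2 = (1 - (norm a)\<^sup>2) * (1 - (norm z)\<^sup>2)"
    unfolding cmod_power2 by (simp add: power2_eq_square algebra_simps)
  moreover have "norm (1 - cnj a * z) \<noteq> 0"
    using disk_denominator[OF assms] by simp
  ultimately show ?thesis
    by (simp add: norm_divide power_divide field_simps)
qed

lemma disk_automorphism_deriv:
  fixes a z :: complex
  assumes "a \<in> ball 0 1" "z \<in> ball 0 1"
  shows "((\<lambda>z. (a - z) / (1 - cnj a * z)) has_field_derivative
      (- of_real (1 - (norm a)\<^sup>2) / (1 - cnj a * z)\<^sup>2)) (at z)"
proof -
  have nz: "1 - cnj a * z \<noteq> 0" using disk_denominator[OF assms] by simp
  have "(-1 * (1 - cnj a * z) - (a - z) * (- cnj a)) = - of_real (1 - (norm a)\<^sup>2)"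
    using complex_norm_square[of a] by (simp add: algebra_simps)
  then show ?thesis
    by (auto intro!: derivative_eq_intros nz simp: power2_eq_square)
qed

lemma disk_automorphism_inj:
  fixes a :: complex
  assumes "a \<in> ball 0 1"
  shows "inj_on (\<lambda>z. (a - z) / (1 - cnj a * z)) (ball 0 1)"
proof (rule inj_onI)
  fix z w assume zw: "z \<in> ball 0 1" "w \<in> ball 0 1"
    and eq: "(a - z) / (1 - cnj a * z) = (a - w) / (1 - cnj a * w)"
  have "(a - z) * (1 - cnj a * w) = (a - w) * (1 - cnj a * z)"
    using eq disk_denominator[OF assms] zw by (simp add: frac_eq_eq)
  then have "(z - w) * (1 - a * cnj a) = 0" by (simp add: algebra_simps)
  moreover have "1 - a * cnj a \<noteq> 0"
    using one_minus_norm_power2_bounds(1)[OF assms]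
    by (metis complex_norm_square of_real_1 of_real_diff of_real_eq_0_iff less_irrefl)
  ultimately show "z = w" by simp
qed

text \<open>The derivative is a constant multiple of the power \<open>(\<alpha> + 2) / p\<close> of the derivative of the disk
  automorphism \<open>\<phi>\<close> exchanging \<open>0\<close> and \<open>a\<close>. Since \<open>(1 - |z|^2) |\<phi>' z| = 1 - |\<phi> z|^2\<close>, substituting
  \<open>w = \<phi> z\<close> bounds the norm independently of \<open>a\<close>.\<close>

lemma dirichlet_extremal_functions:
  assumes \<alpha>: "\<alpha> > -1" and p: "0 < p"
  obtains c where "0 < c"
    "\<And>a. a \<in> ball 0 1 \<Longrightarrow> \<exists>f\<in>dirichlet_space p \<alpha>. dirichlet_norm p \<alpha> f \<le> 1 \<and>
       (\<forall>z\<in>ball 0 1. norm (deriv f z)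
          = c * ((1 - (norm a)\<^sup>2) / (norm (1 - cnj a * z))\<^sup>2) powr ((\<alpha> + 2) / p))"
proof -
  define u where "u = (\<lambda>z::complex. ennreal ((1 - (norm z)\<^sup>2) powr \<alpha>))"
  have [measurable]: "u \<in> borel_measurable borel" unfolding u_def by measurable
  obtain m where m: "0 \<le> m" "(\<integral>\<^sup>+z\<in>ball 0 1. u z \<partial>lborel) = ennreal m"
    using nn_integral_disk_weight_finite[OF \<alpha>] unfolding u_def
    by (cases "\<integral>\<^sup>+z\<in>ball (0::complex) 1. ennreal ((1 - (norm z)\<^sup>2) powr \<alpha>) \<partial>lborel" rule: ennreal_cases) auto
  define s where "s = (\<alpha> + 2) / p"
  \<comment> \<open>Normalises the integral of the extremal function to at most 1: \<open>pi\<close>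
    cancels the normalisation of area, and \<open>m + 1\<close> replaces the mass \<open>m\<close>
    so that no positivity of \<open>m\<close> has to be shown.\<close>
  define c where "c = (pi / (m + 1)) powr (1 / p)"
  have c: "0 < c" "c powr p = pi / (m + 1)"
    using m p by (auto simp: c_def powr_powr)
  show thesis
  proof
    show "0 < c" by (rule c)
    fix a :: complex assume a: "a \<in> ball 0 1"
    define J where "J z = (1 - (norm a)\<^sup>2) / (norm (1 - cnj a * z))\<^sup>2" for z
    define \<phi> where "\<phi> = (\<lambda>z. (a - z) / (1 - cnj a * z))"
    note den = disk_denominator[OF a]
    have na: "0 < 1 - (norm a)\<^sup>2" by (rule one_minus_norm_power2_bounds(1)[OF a])
    have J: "0 < J z" if "z \<in> ball 0 1" for z
      using na den(2)[OF that] by (simp add: J_def)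
    have \<phi>_deriv: "norm (deriv \<phi> z) = J z" if "z \<in> ball 0 1" for z
    proof -
      have "deriv \<phi> z = - of_real (1 - (norm a)\<^sup>2) / (1 - cnj a * z)\<^sup>2"
        unfolding \<phi>_def by (rule DERIV_imp_deriv[OF disk_automorphism_deriv[OF a that]])
      then show ?thesis using na by (simp only: J_def norm_divide norm_power norm_minus_cancel norm_of_real)
    qed
    have \<phi>_holo: "\<phi> holomorphic_on ball 0 1"
      unfolding \<phi>_def holomorphic_on_open[OF open_ball] using disk_automorphism_deriv[OF a] by blast
    have \<phi>_weight: "1 - (norm (\<phi> z))\<^sup>2 = J z * (1 - (norm z)\<^sup>2)" if "z \<in> ball 0 1" for z
      using disk_automorphism_norm[OF a that] by (simp add: \<phi>_def J_def)
    have \<phi>_ball: "\<phi> ` ball 0 1 \<subseteq> ball 0 1"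
    proof
      fix w assume "w \<in> \<phi> ` ball 0 1"
      then obtain z where z: "z \<in> ball 0 1" "w = \<phi> z" by auto
      then have "0 < 1 - (norm w)\<^sup>2"
        using \<phi>_weight J one_minus_norm_power2_bounds(1) by simp
      then show "w \<in> ball 0 1" by (simp add: power_less_one_iff abs_square_less_1)
    qed
    \<comment> \<open>The power \<open>s\<close> of the automorphism's derivative, up to a
      unimodular constant and the factor \<open>c\<close>; the complex power is formed with the
      principal logarithm.\<close>
    define k where "k z = of_real (c * (1 - (norm a)\<^sup>2) powr s) * exp (of_real (- 2 * s) * Ln (1 - cnj a * z))" for z
    have norm_k: "norm (k z) = c * J z powr s" if "z \<in> ball 0 1" for z
    proof -
      have "norm (exp (of_real (- 2 * s) * Ln (1 - cnj a * z))) = norm (1 - cnj a * z) powr (- 2 * s)"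
        using den(2)[OF that] by (simp add: powr_def)
      also have "\<dots> = ((norm (1 - cnj a * z))\<^sup>2) powr (- s)"
        using den(2)[OF that] powr_powr[of "norm (1 - cnj a * z)" 2 "- s"] by simp
      finally have "norm (k z) = c * (1 - (norm a)\<^sup>2) powr s * ((norm (1 - cnj a * z))\<^sup>2) powr (- s)"
        using c by (simp add: k_def norm_mult)
      also have "\<dots> = c * J z powr s"
        using na by (simp add: J_def powr_divide powr_minus_divide)
      finally show ?thesis .
    qed
    \<comment> \<open>The denominator has positive real part on the disk and so avoids the branch
      cut of \<open>Ln\<close>.\<close>
    have "k holomorphic_on ball 0 1"
      unfolding k_def using den(1)
      by (intro holomorphic_intros) (auto simp: complex_nonpos_Reals_iff not_le)
    then obtain G where G: "\<And>x. x \<in> ball 0 1 \<Longrightarrow> (G has_field_derivative k x) (at x within ball 0 1)"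
      using holomorphic_convex_primitive'[of "ball 0 1" k] by auto
    \<comment> \<open>Subtracting \<open>G 0\<close> removes the contribution of the origin to
      \<open>dirichlet_norm\<close>.\<close>
    define f where "f = (\<lambda>z. G z - G 0)"
    have f_der: "(f has_field_derivative k x) (at x)" if "x \<in> ball 0 1" for x
    proof -
      have "(G has_field_derivative k x) (at x)"
        using G[OF that] by (simp only: at_within_open[OF that open_ball])
      then show ?thesis
        unfolding f_def using DERIV_diff[OF _ DERIV_const] by fastforce
    qed
    have f_holo: "f holomorphic_on ball 0 1"
      using f_der unfolding holomorphic_on_open[OF open_ball] by blast
    have norm_f: "norm (deriv f z) = c * J z powr s" if "z \<in> ball 0 1" for z
      using DERIV_imp_deriv[OF f_der[OF that]] norm_k[OF that] by simp
    have int_le: "(\<integral>\<^sup>+z. ennreal (norm (deriv f z) powr p) \<partial>disk_measure \<alpha>) \<le> 1"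
    proof -
      have pt: "norm (deriv f z) powr p * (1 - (norm z)\<^sup>2) powr \<alpha> / pi
          = 1 / (m + 1) * ((1 - (norm (\<phi> z))\<^sup>2) powr \<alpha> * (norm (deriv \<phi> z))\<^sup>2)" if z: "z \<in> ball 0 1" for z
      proof -
        have "norm (deriv f z) powr p = c powr p * J z powr (\<alpha> + 2)"
          using norm_f[OF z] J[OF z] c p by (simp add: powr_mult powr_powr s_def)
        also have "J z powr (\<alpha> + 2) = J z powr \<alpha> * (J z)\<^sup>2"
          using J[OF z] by (simp add: powr_add)
        finally have "norm (deriv f z) powr p * (1 - (norm z)\<^sup>2) powr \<alpha> / pi
            = c powr p / pi * ((J z powr \<alpha> * (1 - (norm z)\<^sup>2) powr \<alpha>) * (J z)\<^sup>2)"
          by simp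
        also have "J z powr \<alpha> * (1 - (norm z)\<^sup>2) powr \<alpha> = (1 - (norm (\<phi> z))\<^sup>2) powr \<alpha>"
          using \<phi>_weight[OF z] J[OF z] one_minus_norm_power2_bounds(1)[OF z]
          by (simp add: powr_mult)
        finally show ?thesis using \<phi>_deriv[OF z] c(2) by simp
      qed
      have pt': "(m + 1) * (norm (deriv f z) powr p * (1 - (norm z)\<^sup>2) powr \<alpha> / pi)
          = (1 - (norm (\<phi> z))\<^sup>2) powr \<alpha> * (norm (deriv \<phi> z))\<^sup>2" if "z \<in> ball 0 1" for z
        unfolding pt[OF that] using m(1) by simp
      have "(\<integral>\<^sup>+z. ennreal (norm (deriv f z) powr p) \<partial>disk_measure \<alpha>)
          = (\<integral>\<^sup>+z\<in>ball 0 1. ennreal (norm (deriv f z) powr p * (1 - (norm z)\<^sup>2) powr \<alpha> / pi) \<partial>lborel)"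
        by (intro nn_integral_disk_measure dirichlet_space_cont_deriv f_holo p) auto
      also have "\<dots> = (\<integral>\<^sup>+z. ennreal (1 / (m + 1)) * (u (\<phi> z) * ennreal ((norm (deriv \<phi> z))\<^sup>2) * indicator (ball 0 1) z) \<partial>lborel)"
        using m by (intro nn_integral_cong) (auto simp: indicator_def u_def ennreal_mult'[symmetric] pt)
      also have "\<dots> = ennreal (1 / (m + 1)) * (\<integral>\<^sup>+z\<in>ball 0 1. (u (\<phi> z) * ennreal ((norm (deriv \<phi> z))\<^sup>2)) \<partial>lborel)"
      proof (rule nn_integral_cmult)
        \<comment> \<open>Measurability is read off from the left side of \<open>pt'\<close>, which
          is continuous on the disk; this avoids any statement about \<open>\<phi>\<close> outside
          it.\<close>
        have "continuous_on (ball 0 1) (\<lambda>z. norm (deriv f z) powr p * (1 - (norm z)\<^sup>2) powr \<alpha> / pi)"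
          using one_minus_norm_power2_bounds(1)
          by (intro continuous_on_divide continuous_on_mult dirichlet_space_cont_deriv f_holo p
              continuous_on_powr continuous_intros) force+
        then have "continuous_on (ball 0 1) (\<lambda>z. (m + 1) * (norm (deriv f z) powr p * (1 - (norm z)\<^sup>2) powr \<alpha> / pi))"
          by (intro continuous_on_mult continuous_on_const)
        then have "(\<lambda>z. ennreal (indicator (ball 0 1) z * ((m + 1) * (norm (deriv f z) powr p * (1 - (norm z)\<^sup>2) powr \<alpha> / pi)))) \<in> borel_measurable lborel"
          using borel_measurable_continuous_on_indicator[of "ball 0 1"
            "\<lambda>z. (m + 1) * (norm (deriv f z) powr p * (1 - (norm z)\<^sup>2) powr \<alpha> / pi)"] by simp
        then show "(\<lambda>z. u (\<phi> z) * ennreal ((norm (deriv \<phi> z))\<^sup>2) * indicator (ball 0 1) z) \<in> borel_measurable lborel"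
          by (rule measurable_cong[THEN iffD1, rotated])
            (auto simp: indicator_def u_def ennreal_mult'[symmetric] pt' simp del: times_divide_eq_right)
      qed
      also have "(\<integral>\<^sup>+z\<in>ball 0 1. (u (\<phi> z) * ennreal ((norm (deriv \<phi> z))\<^sup>2)) \<partial>lborel) = (\<integral>\<^sup>+w\<in>\<phi> ` ball 0 1. u w \<partial>lborel)"
        using disk_automorphism_inj[OF a] \<phi>_holo
        by (intro nn_integral_holomorphic_substitution[symmetric]) (auto simp: \<phi>_def)
      also have "\<dots> \<le> (\<integral>\<^sup>+w\<in>ball 0 1. u w \<partial>lborel)"
        using \<phi>_ball by (intro nn_integral_mono) (auto simp: indicator_def)
      also have "\<dots> = ennreal m" by (rule m)
      also have "ennreal (1 / (m + 1)) * ennreal m \<le> 1"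
        using m(1) by (simp add: ennreal_mult'[symmetric] field_simps)
      finally show ?thesis by (auto simp: mult_left_mono)
    qed
    then have f_mem: "f \<in> dirichlet_space p \<alpha>"
      using f_holo by (auto simp: dirichlet_space_def intro: le_less_trans)
    have "ennreal (\<integral>z. norm (deriv f z) powr p \<partial>disk_measure \<alpha>) \<le> ennreal 1"
      using int_le dirichlet_nn_integral_eq[OF f_mem p] by simp
    then have "(\<integral>z. norm (deriv f z) powr p \<partial>disk_measure \<alpha>) \<le> 1"
      by (subst (asm) ennreal_le_iff) auto
    moreover have "f 0 = 0" by (simp add: f_def)
    ultimately have "dirichlet_norm p \<alpha> f \<le> 1"
      using p unfolding dirichlet_norm_def by (intro powr_le1) auto
    then show "\<exists>f\<in>dirichlet_space p \<alpha>. dirichlet_norm p \<alpha> f \<le> 1 \<and>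
       (\<forall>z\<in>ball 0 1. norm (deriv f z)
          = c * ((1 - (norm a)\<^sup>2) / (norm (1 - cnj a * z))\<^sup>2) powr ((\<alpha> + 2) / p))"
      using f_mem norm_f by (intro bexI[of _ f]) (auto simp: J_def s_def)
  qed
qed

section \<open>Order boundedness\<close>

lemma powr_mult_powr_minus:
  fixes x \<delta> :: real
  assumes "0 < \<delta>" "0 \<le> x"
  shows "(x * \<delta> powr (- (t / p))) powr q = x powr q / \<delta> powr (q * t / p)"
proof -
  have "(x * \<delta> powr (- (t / p))) powr q = x powr q * (\<delta> powr (- (t / p))) powr q"
    using assms by (simp add: powr_mult)
  also have "(\<delta> powr (- (t / p))) powr q = \<delta> powr (- (q * t / p))"
    unfolding powr_powr by (simp add: mult.commute)
  finally show ?thesis by (simp only: powr_minus_divide) simp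
qed

text \<open>The exceptional null set in the definition of order boundedness depends on the function, so the
  extremal functions are used for a countable dense set of parameters \<open>a\<close>; the bound extends to
  \<open>a = z\<close> by continuity in \<open>a\<close>.\<close>

lemma order_bounded_S_op_imp_integrable:
  assumes \<alpha>: "\<alpha> > -1" and g: "g holomorphic_on ball 0 1" and p: "0 < p" and q: "0 < q"
    and ob: "order_bounded p \<alpha> q \<beta> (S_op g)"
  shows "(\<integral>\<^sup>+ z. ennreal (norm (g z) powr q / (1 - (norm z)\<^sup>2) powr (q * (\<alpha> + 2) / p)) \<partial>disk_measure \<beta>) < \<infinity>"
proof -
  define s where "s = (\<alpha> + 2) / p"
  obtain h where h0: "\<forall>z\<in>ball 0 1. 0 \<le> h z" and hL: "Lq_fun q (disk_measure \<beta>) h"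
    and hb: "\<forall>f\<in>dirichlet_space p \<alpha>. dirichlet_norm p \<alpha> f \<le> 1 \<longrightarrow>
             (AE z in disk_measure \<beta>. norm (deriv (S_op g f) z) \<le> h z)"
    using ob unfolding order_bounded_def by blast
  obtain c where c: "0 < c" and ex: "\<And>a. a \<in> ball 0 1 \<Longrightarrow> \<exists>f\<in>dirichlet_space p \<alpha>. dirichlet_norm p \<alpha> f \<le> 1 \<and>
       (\<forall>z\<in>ball 0 1. norm (deriv f z)
          = c * ((1 - (norm a)\<^sup>2) / (norm (1 - cnj a * z))\<^sup>2) powr s)"
    using dirichlet_extremal_functions[OF \<alpha> p] unfolding s_def by blast
  \<comment> \<open>The modulus of the derivative of \<open>S_op g f\<close> for the extremal
    \<open>f\<close> with parameter \<open>a\<close>. On the diagonal \<open>a = z\<close> it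
    becomes \<open>c * |g z| * (1 - |z|^2) powr (- s)\<close>, whose \<open>q\<close>-th power is a
    constant times the integrand of the claim.\<close>
  define k where "k z a = c * ((1 - (norm a)\<^sup>2) / (norm (1 - cnj a * z))\<^sup>2) powr s * norm (g z)" for z a :: complex
  have AE_k: "AE z in disk_measure \<beta>. k z a \<le> h z" if a: "a \<in> ball 0 1" for a
  proof -
    obtain f where f: "f \<in> dirichlet_space p \<alpha>" "dirichlet_norm p \<alpha> f \<le> 1"
      "\<And>z. z \<in> ball 0 1 \<Longrightarrow> norm (deriv f z) = c * ((1 - (norm a)\<^sup>2) / (norm (1 - cnj a * z))\<^sup>2) powr s"
      using ex[OF a] by blast
    then have fh: "f holomorphic_on ball 0 1" by (simp add: dirichlet_space_def)
    have "AE z in disk_measure \<beta>. norm (deriv (S_op g f) z) \<le> h z" using hb f by blast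
    moreover have "AE z in disk_measure \<beta>. norm (deriv (S_op g f) z) = k z a"
      by (rule AE_disk_measure_imp) (simp only: S_op_holomorphic_deriv(2)[OF fh g] norm_mult f(3) k_def)
    ultimately show ?thesis by eventually_elim simp
  qed
  obtain D :: "complex set" where D: "countable D" "\<And>X. open X \<Longrightarrow> X \<noteq> {} \<Longrightarrow> \<exists>d\<in>D. d \<in> X"
    using countable_dense_exists by blast
  have "AE z in disk_measure \<beta>. \<forall>a\<in>D \<inter> ball 0 1. k z a \<le> h z"
    using D(1) AE_k by (subst AE_ball_countable) auto
  moreover have "AE z in disk_measure \<beta>. z \<in> ball 0 1"
    by (rule AE_disk_measure_imp)
  ultimately have AE_h: "AE z in disk_measure \<beta>. z \<in> ball 0 1 \<and> k z z \<le> h z"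
  proof eventually_elim
    case (elim z)
    have "k z z \<le> h z"
    \<comment> \<open>A strict violation at \<open>a = z\<close> persists on a neighbourhood of
      \<open>z\<close>, which contains a point of \<open>D\<close>.\<close>
    proof (rule ccontr)
      assume n: "\<not> k z z \<le> h z"
      have "continuous_on (ball 0 1) (k z)"
      proof -
        have den: "(norm (1 - cnj a * z))\<^sup>2 \<noteq> 0" if "a \<in> ball 0 1" for a
          using disk_denominator(2)[OF that elim(2)] by simp
        have "(1 - (norm a)\<^sup>2) / (norm (1 - cnj a * z))\<^sup>2 \<noteq> 0" if "a \<in> ball 0 1" for a
          using den[OF that] one_minus_norm_power2_bounds(1)[OF that] by simp
        then show ?thesis
          unfolding k_def using den
          by (intro continuous_on_mult continuous_on_powr continuous_on_divide continuous_intros) auto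
      qed
      then have "open (ball 0 1 \<inter> k z -` {h z<..})"
        by (rule continuous_open_preimage) auto
      moreover have "z \<in> ball 0 1 \<inter> k z -` {h z<..}" using n elim(2) by auto
      ultimately obtain d where "d \<in> D" "d \<in> ball 0 1 \<inter> k z -` {h z<..}"
        using D(2) by blast
      then show False using elim(1) by force
    qed
    then show ?case using elim(2) by simp
  qed
  have bound: "norm (g z) powr q / (1 - (norm z)\<^sup>2) powr (q * (\<alpha> + 2) / p) \<le> c powr (-q) * \<bar>h z\<bar> powr q"
    if z: "z \<in> ball 0 1" and le: "k z z \<le> h z" for z
  proof -
    define \<delta> where "\<delta> = 1 - (norm z)\<^sup>2"
    have \<delta>: "\<delta> > 0" using one_minus_norm_power2_bounds(1)[OF z] by (simp add: \<delta>_def)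
    have "1 - cnj z * z = of_real \<delta>"
      using complex_norm_square[of z] by (simp add: \<delta>_def mult.commute)
    then have "norm (1 - cnj z * z) = \<delta>" using \<delta> by simp
    then have kz: "k z z = c * \<delta> powr (-s) * norm (g z)"
    proof -
      have "(1 - (norm z)\<^sup>2) / (norm (1 - cnj z * z))\<^sup>2 = 1 / \<delta>"
        using \<delta> \<open>norm (1 - cnj z * z) = \<delta>\<close> by (simp only: \<delta>_def[symmetric]) (simp add: power2_eq_square)
      then show ?thesis
        unfolding k_def using \<delta> by (simp add: powr_divide powr_minus_divide)
    qed
    have "norm (g z) powr q / \<delta> powr (q * (\<alpha> + 2) / p) = (norm (g z) * \<delta> powr (-s)) powr q"
      unfolding s_def using \<delta> by (intro powr_mult_powr_minus[symmetric]) auto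
    also have "\<dots> = c powr (-q) * (k z z) powr q"
    proof -
      have "(k z z) powr q = c powr q * (norm (g z) * \<delta> powr (-s)) powr q"
        using c by (simp add: kz powr_mult mult_ac)
      moreover have "c powr (-q) * c powr q = 1" using c by (simp add: powr_add[symmetric])
      ultimately show ?thesis by (simp only: mult.assoc[symmetric] mult_1_left)
    qed
    also have "\<dots> \<le> c powr (-q) * \<bar>h z\<bar> powr q"
      using le q c by (intro mult_left_mono powr_mono2) (auto simp: kz)
    finally show ?thesis by (simp add: \<delta>_def)
  qed
  have [measurable]: "h \<in> borel_measurable (disk_measure \<beta>)" and hfin: "(\<integral>\<^sup>+z. ennreal (\<bar>h z\<bar> powr q) \<partial>disk_measure \<beta>) < \<infinity>"
    using hL by (auto simp: Lq_fun_def)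
  have "(\<integral>\<^sup>+ z. ennreal (norm (g z) powr q / (1 - (norm z)\<^sup>2) powr (q * (\<alpha> + 2) / p)) \<partial>disk_measure \<beta>)
      \<le> (\<integral>\<^sup>+ z. ennreal (c powr (-q)) * ennreal (\<bar>h z\<bar> powr q) \<partial>disk_measure \<beta>)"
  proof (rule nn_integral_mono_AE)
    show "AE z in disk_measure \<beta>. ennreal (norm (g z) powr q / (1 - (norm z)\<^sup>2) powr (q * (\<alpha> + 2) / p))
        \<le> ennreal (c powr (-q)) * ennreal (\<bar>h z\<bar> powr q)"
      using AE_h
    proof eventually_elim
      case (elim z)
      then show ?case
        using bound[of z] by (simp add: ennreal_mult'[symmetric] ennreal_leI)
    qed
  qed
  also have "\<dots> = ennreal (c powr (-q)) * (\<integral>\<^sup>+ z. ennreal (\<bar>h z\<bar> powr q) \<partial>disk_measure \<beta>)"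
    by (rule nn_integral_cmult) measurable
  also have "\<dots> < \<infinity>"
    using hfin by (simp add: ennreal_mult_less_top)
  finally show ?thesis .
qed

text \<open>The finiteness condition says that \<open>w\<close>, the product of \<open>|g|\<close>
  and the growth rate, has finite \<open>q\<close>-th power integral, and pointwise growth turns a
  constant multiple of \<open>w\<close> into an order bound. The same domination yields the mapping
  property contained in \<open>order_bounded\<close>.\<close>

lemma integrable_imp_order_bounded_S_op:
  assumes g: "g holomorphic_on ball 0 1" and p: "0 < p" and q: "0 < q"
    and fin: "(\<integral>\<^sup>+ z. ennreal (norm (g z) powr q / (1 - (norm z)\<^sup>2) powr (q * (\<alpha> + 2) / p)) \<partial>disk_measure \<beta>) < \<infinity>"
  shows "order_bounded p \<alpha> q \<beta> (S_op g)"
proof -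
  define s where "s = (\<alpha> + 2) / p"
  define w where "w z = norm (g z) * (1 - (norm z)\<^sup>2) powr (-s)" for z
  have w0: "w z \<ge> 0" for z by (simp add: w_def)
  have w_cont: "continuous_on (ball 0 1) w"
    unfolding w_def using one_minus_norm_power2_bounds(1) g
    by (intro continuous_on_mult continuous_on_powr continuous_intros holomorphic_on_imp_continuous_on) force+
  have w_eq: "w z powr q = norm (g z) powr q / (1 - (norm z)\<^sup>2) powr (q * (\<alpha> + 2) / p)"
    if "z \<in> ball 0 1" for z
    using one_minus_norm_power2_bounds(1)[OF that]
    unfolding w_def s_def by (intro powr_mult_powr_minus) auto
  have w_meas [measurable]: "w \<in> borel_measurable (disk_measure \<beta>)"
    using w_cont by (rule borel_measurable_disk_measure)
  have w_fin: "(\<integral>\<^sup>+z. ennreal (w z powr q) \<partial>disk_measure \<beta>) < \<infinity>"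
  proof -
    have "(\<integral>\<^sup>+z. ennreal (w z powr q) \<partial>disk_measure \<beta>)
        = (\<integral>\<^sup>+ z. ennreal (norm (g z) powr q / (1 - (norm z)\<^sup>2) powr (q * (\<alpha> + 2) / p)) \<partial>disk_measure \<beta>)"
      by (intro nn_integral_cong_AE AE_disk_measure_imp) (simp only: w_eq)
    then show ?thesis using fin by simp
  qed
  have w_fin_mult: "(\<integral>\<^sup>+z. ennreal ((K * w z) powr q) \<partial>disk_measure \<beta>) < \<infinity>" if K: "0 \<le> K" for K
  proof -
    have "(\<integral>\<^sup>+z. ennreal ((K * w z) powr q) \<partial>disk_measure \<beta>)
        = (\<integral>\<^sup>+z. ennreal (K powr q) * ennreal (w z powr q) \<partial>disk_measure \<beta>)"
      using K w0 by (simp add: powr_mult ennreal_mult')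
    also have "\<dots> = ennreal (K powr q) * (\<integral>\<^sup>+z. ennreal (w z powr q) \<partial>disk_measure \<beta>)"
      by (rule nn_integral_cmult) measurable
    also have "\<dots> < \<infinity>" using w_fin by (simp add: ennreal_mult_less_top)
    finally show ?thesis .
  qed
  obtain C where C: "0 < C" and growth: "\<And>F I z. \<lbrakk>F holomorphic_on ball 0 1; 0 \<le> I; z \<in> ball 0 1;
        (\<integral>\<^sup>+w. ennreal (norm (F w) powr p) \<partial>disk_measure \<alpha>) \<le> ennreal I\<rbrakk>
      \<Longrightarrow> norm (F z) powr p * (1 - (norm z)\<^sup>2) powr (\<alpha> + 2) \<le> C * I"
    using disk_pointwise_growth[OF p] by blast
  \<comment> \<open>Stated for arbitrary \<open>I\<close> because it serves twice: with the actual
    integral of \<open>f\<close> for the mapping property, and with \<open>I = 1\<close> on the unit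
    ball.\<close>
  have S_bound: "norm (deriv (S_op g f) z) \<le> (C * I) powr (1 / p) * w z"
    if f: "f holomorphic_on ball 0 1" and I: "0 \<le> I" and z: "z \<in> ball 0 1"
      and le: "(\<integral>\<^sup>+z. ennreal (norm (deriv f z) powr p) \<partial>disk_measure \<alpha>) \<le> ennreal I" for f I z
  proof -
    define \<delta> where "\<delta> = 1 - (norm z)\<^sup>2"
    have \<delta>: "\<delta> > 0" using one_minus_norm_power2_bounds(1)[OF z] by (simp add: \<delta>_def)
    have "norm (deriv f z) powr p * \<delta> powr (\<alpha> + 2) \<le> C * I"
      unfolding \<delta>_def using f by (intro growth[of "deriv f"] I z le holomorphic_deriv) auto
    then have "(norm (deriv f z) powr p * \<delta> powr (\<alpha> + 2)) powr (1 / p) \<le> (C * I) powr (1 / p)"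
      using p by (intro powr_mono2) auto
    then have "norm (deriv f z) * \<delta> powr s \<le> (C * I) powr (1 / p)"
      using p by (simp add: powr_mult powr_powr s_def)
    then have "norm (deriv f z) * \<delta> powr s * (norm (g z) * \<delta> powr (-s)) \<le> (C * I) powr (1 / p) * (norm (g z) * \<delta> powr (-s))"
      by (intro mult_right_mono) auto
    moreover have "norm (deriv f z) * \<delta> powr s * (norm (g z) * \<delta> powr (-s)) = norm (deriv f z * g z) * (\<delta> powr s * \<delta> powr (-s))"
      by (simp only: norm_mult mult_ac)
    moreover have "\<delta> powr s * \<delta> powr (-s) = 1" using \<delta> by (simp add: powr_add[symmetric])
    ultimately show ?thesis
      unfolding S_op_holomorphic_deriv(2)[OF f g z] w_def \<delta>_def[symmetric] by (simp only: mult_1_right)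
  qed
  have "S_op g f \<in> dirichlet_space q \<beta>" if f: "f \<in> dirichlet_space p \<alpha>" for f
  proof -
    have fh: "f holomorphic_on ball 0 1" using f by (simp add: dirichlet_space_def)
    define I where "I = (\<integral>z. norm (deriv f z) powr p \<partial>disk_measure \<alpha>)"
    have I0: "0 \<le> I" by (simp add: I_def)
    have le: "(\<integral>\<^sup>+z. ennreal (norm (deriv f z) powr p) \<partial>disk_measure \<alpha>) \<le> ennreal I"
      using dirichlet_nn_integral_eq[OF f p] by (simp add: I_def)
    have "(\<integral>\<^sup>+z. ennreal (norm (deriv (S_op g f) z) powr q) \<partial>disk_measure \<beta>)
        \<le> (\<integral>\<^sup>+z. ennreal (((C * I) powr (1 / p) * w z) powr q) \<partial>disk_measure \<beta>)"
      using q by (intro nn_integral_mono_AE AE_disk_measure_imp ennreal_leI powr_mono2 S_bound fh I0 le) auto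
    also have "\<dots> < \<infinity>" by (rule w_fin_mult) simp
    finally show ?thesis
      using S_op_holomorphic_deriv(1)[OF fh g] by (simp add: dirichlet_space_def)
  qed
  moreover have "\<exists>h. (\<forall>z\<in>ball 0 1. 0 \<le> h z) \<and> Lq_fun q (disk_measure \<beta>) h \<and>
          (\<forall>f\<in>dirichlet_space p \<alpha>. dirichlet_norm p \<alpha> f \<le> 1 \<longrightarrow>
             (AE z in disk_measure \<beta>. norm (deriv (S_op g f) z) \<le> h z))"
  proof (intro exI[of _ "\<lambda>z. C powr (1 / p) * w z"] conjI ballI impI)
    show "0 \<le> C powr (1 / p) * w z" for z using w0 by simp
    have "\<bar>C powr (1 / p) * w z\<bar> = C powr (1 / p) * w z" for z using w0 by simp
    then show "Lq_fun q (disk_measure \<beta>) (\<lambda>z. C powr (1 / p) * w z)"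
      unfolding Lq_fun_def using w_fin_mult[of "C powr (1 / p)"] by simp
    fix f assume f: "f \<in> dirichlet_space p \<alpha>" and nf: "dirichlet_norm p \<alpha> f \<le> 1"
    have fh: "f holomorphic_on ball 0 1" using f by (simp add: dirichlet_space_def)
    define I where "I = (\<integral>z. norm (deriv f z) powr p \<partial>disk_measure \<alpha>)"
    have I0: "0 \<le> I" by (simp add: I_def)
    \<comment> \<open>Undoing the root and discarding the nonnegative term at the origin leaves
      \<open>I \<le> 1\<close>.\<close>
    have "(norm (f 0) powr p + I) powr (1 / p) \<le> 1"
      using nf by (simp add: dirichlet_norm_def I_def)
    then have "((norm (f 0) powr p + I) powr (1 / p)) powr p \<le> 1"
      using p by (intro powr_le1) auto
    then have "norm (f 0) powr p + I \<le> 1"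
      using p I0 by (simp add: powr_powr)
    moreover have "0 \<le> norm (f 0) powr p" by simp
    ultimately have "I \<le> 1" by linarith
    then have "(\<integral>\<^sup>+z. ennreal (norm (deriv f z) powr p) \<partial>disk_measure \<alpha>) \<le> ennreal 1"
      using dirichlet_nn_integral_eq[OF f p] by (simp add: I_def ennreal_leI)
    then show "AE z in disk_measure \<beta>. norm (deriv (S_op g f) z) \<le> C powr (1 / p) * w z"
      using S_bound[OF fh, of 1] by (intro AE_disk_measure_imp) simp
  qed
  ultimately show ?thesis unfolding order_bounded_def by blast
qed

theorem theorem10:
  fixes \<alpha> \<beta> p q :: real and g :: "complex \<Rightarrow> complex"
  assumes "\<alpha> > -1" and "\<beta> > -1"
    and "g holomorphic_on ball 0 1"
    and "0 < p" and "0 < q"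
  shows "order_bounded p \<alpha> q \<beta> (S_op g) \<longleftrightarrow>
    (\<integral>\<^sup>+ z. ennreal (norm (g z) powr q / (1 - (norm z)\<^sup>2) powr (q * (\<alpha> + 2) / p))
       \<partial>disk_measure \<beta>) < \<infinity>"
  using order_bounded_S_op_imp_integrable[OF assms(1,3-5)]
    integrable_imp_order_bounded_S_op[OF assms(3-5)] by blast

end
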